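(* Let $L=1$, $a=1$, let $b(x)=0$ for $0<x\le\frac12$ and $b(x)=1$ for $\frac12<x\le 1$, and let $c(x)=c$ be a constant function with $c\in\mathbb{R}$. Let $\mathcal{A}$ be the operator on $\mathcal{H}$ defined in the context. Then the semigroup of contractions $(e^{t\mathcal{A}})_{t\ge0}$ generated by $\mathcal{A}$ is not exponentially stable in $\mathcal{H}$, i.e. there do not exist constants $M,\epsilon>0$ such that $\|e^{t\mathcal{A}}U_0\|_{\mathcal{H}}\le Me^{-\epsilon t}\|U_0\|_{\mathcal{H}}$ for all $t>0$ and all $U_0\in\mathcal{H}$.
   Context: Functions are complex valued. The energy space is $\mathcal{H}=(H_0^1(0,1)\times L^2(0,1))^2$ with norm $\|(u,v,y,z)\|_{\mathcal{H}}^2=\int_0^1(|v|^2+|u_x|^2+|z|^2+|y_x|^2)\,dx$. The unbounded operator $\mathcal{A}$ on $\mathcal{H}$ has domain $$D(\mathcal{A})=\{(u,v,y,z)\in\mathcal{H}:\ y\in H^2(0,1)\cap H_0^1(0,1),\ v,z\in H_0^1(0,1),\ (u_x+b(x)v_x)_x\in L^2(0,1)\}$$ and $\mathcal{A}(u,v,y,z)=(v,\ (u_x+b(x)v_x)_x-cz,\ z,\ y_{xx}+cv)$. It generates a $C_0$-semigroup of contractions on $\mathcal{H}$. *)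

theory Defs
  imports "HOL-Analysis.Analysis"
begin

section \<open>The complex space L2(0,1)\<close>

abbreviation unit_measure :: "real measure" where
  "unit_measure \<equiv> lebesgue_on {0<..<1}"

definition square_integrable :: "(real \<Rightarrow> complex) \<Rightarrow> bool" where
  "square_integrable f \<longleftrightarrow>
     f \<in> borel_measurable unit_measure \<and> integrable unit_measure (\<lambda>x. (cmod (f x))\<^sup>2)"

definition l2_eq :: "(real \<Rightarrow> complex) \<Rightarrow> (real \<Rightarrow> complex) \<Rightarrow> bool" where
  "l2_eq f g \<longleftrightarrow>
     square_integrable f \<and> square_integrable g \<and> (AE x in unit_measure. f x = g x)"

lemma l2_eq_AE:
  assumes "l2_eq f f'" "\<And>x. f x = f' x \<Longrightarrow> P x"
  shows "AE x in unit_measure. P x"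
proof -
  have "AE x in unit_measure. f x = f' x" using assms(1) by (simp add: l2_eq_def)
  then show ?thesis by eventually_elim (rule assms(2))
qed

lemma l2_eq_AE2:
  assumes "l2_eq f f'" "l2_eq g g'" "\<And>x. f x = f' x \<Longrightarrow> g x = g' x \<Longrightarrow> P x"
  shows "AE x in unit_measure. P x"
proof -
  have "AE x in unit_measure. f x = f' x" "AE x in unit_measure. g x = g' x"
    using assms(1,2) by (simp_all add: l2_eq_def)
  then show ?thesis by eventually_elim (rule assms(3))
qed

lemma square_integrable_zero: "square_integrable (\<lambda>x. 0)"
  by (simp add: square_integrable_def)

lemma square_integrable_mult:
  assumes "square_integrable f" "square_integrable g"
  shows "integrable unit_measure (\<lambda>x. f x * g x)"
proof (rule Bochner_Integration.integrable_bound)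
  show "integrable unit_measure (\<lambda>x. (cmod (f x))\<^sup>2 + (cmod (g x))\<^sup>2)"
    using assms by (auto simp: square_integrable_def)
  show "(\<lambda>x. f x * g x) \<in> borel_measurable unit_measure"
    using assms by (auto simp: square_integrable_def)
  have "cmod (f x * g x) \<le> norm ((cmod (f x))\<^sup>2 + (cmod (g x))\<^sup>2)" for x
  proof -
    have "2 * cmod (f x) * cmod (g x) \<le> (cmod (f x))\<^sup>2 + (cmod (g x))\<^sup>2"
      by (rule sum_squares_bound)
    moreover have "0 \<le> cmod (f x) * cmod (g x)" by simp
    ultimately have "cmod (f x) * cmod (g x) \<le> (cmod (f x))\<^sup>2 + (cmod (g x))\<^sup>2" by linarith
    then show ?thesis by (simp add: norm_mult)
  qed
  then show "AE x in unit_measure. cmod (f x * g x) \<le> norm ((cmod (f x))\<^sup>2 + (cmod (g x))\<^sup>2)"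
    by simp
qed

lemma square_integrable_cnj:
  assumes "square_integrable f"
  shows "square_integrable (\<lambda>x. cnj (f x))"
proof -
  have "cnj \<in> borel_measurable borel"
    by (intro borel_measurable_continuous_onI continuous_intros)
  then have "(\<lambda>x. cnj (f x)) \<in> borel_measurable unit_measure"
    using assms unfolding square_integrable_def by (auto intro: measurable_compose)
  then show ?thesis using assms by (simp add: square_integrable_def)
qed

lemma square_integrable_bounded_mult:
  assumes "square_integrable f" "k \<in> borel_measurable unit_measure" "\<And>x. cmod (k x) \<le> B"
  shows "square_integrable (\<lambda>x. k x * f x)"
  unfolding square_integrable_def
proof
  show meas: "(\<lambda>x. k x * f x) \<in> borel_measurable unit_measure"
    using assms by (auto simp: square_integrable_def)
  show "integrable unit_measure (\<lambda>x. (cmod (k x * f x))\<^sup>2)"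
  proof (rule Bochner_Integration.integrable_bound)
    show "integrable unit_measure (\<lambda>x. B\<^sup>2 * (cmod (f x))\<^sup>2)"
      using assms by (auto simp: square_integrable_def)
    show "(\<lambda>x. (cmod (k x * f x))\<^sup>2) \<in> borel_measurable unit_measure"
      using meas by measurable
    have "(cmod (k x * f x))\<^sup>2 \<le> B\<^sup>2 * (cmod (f x))\<^sup>2" for x
      using power_mono[OF assms(3)[of x], of 2]
      by (simp add: norm_mult power_mult_distrib mult_right_mono)
    then show "AE x in unit_measure. norm ((cmod (k x * f x))\<^sup>2) \<le> norm (B\<^sup>2 * (cmod (f x))\<^sup>2)"
      by simp
  qed
qed

lemma square_integrable_add:
  assumes "square_integrable f" "square_integrable g"
  shows "square_integrable (\<lambda>x. f x + g x)"
  unfolding square_integrable_def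
proof
  show meas: "(\<lambda>x. f x + g x) \<in> borel_measurable unit_measure"
    using assms by (auto simp: square_integrable_def)
  show "integrable unit_measure (\<lambda>x. (cmod (f x + g x))\<^sup>2)"
  proof (rule Bochner_Integration.integrable_bound)
    show "integrable unit_measure (\<lambda>x. 2 * (cmod (f x))\<^sup>2 + 2 * (cmod (g x))\<^sup>2)"
      using assms by (auto simp: square_integrable_def)
    show "(\<lambda>x. (cmod (f x + g x))\<^sup>2) \<in> borel_measurable unit_measure"
      using meas by measurable
    have "(cmod (f x + g x))\<^sup>2 \<le> 2 * (cmod (f x))\<^sup>2 + 2 * (cmod (g x))\<^sup>2" for x
    proof -
      have "(cmod (f x + g x))\<^sup>2 \<le> (cmod (f x) + cmod (g x))\<^sup>2"
        by (intro power_mono norm_triangle_ineq) simp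
      also have "\<dots> = (cmod (f x))\<^sup>2 + (cmod (g x))\<^sup>2 + 2 * cmod (f x) * cmod (g x)"
        by (rule power2_sum)
      also have "\<dots> \<le> 2 * (cmod (f x))\<^sup>2 + 2 * (cmod (g x))\<^sup>2"
        using sum_squares_bound[of "cmod (f x)" "cmod (g x)"] by linarith
      finally show ?thesis .
    qed
    then show "AE x in unit_measure.
        norm ((cmod (f x + g x))\<^sup>2) \<le> norm (2 * (cmod (f x))\<^sup>2 + 2 * (cmod (g x))\<^sup>2)"
      by simp
  qed
qed

lemma square_integrable_cmult:
  "square_integrable f \<Longrightarrow> square_integrable (\<lambda>x. a * f x)"
  by (rule square_integrable_bounded_mult[where B = "cmod a"]) auto

lemma square_integrable_uminus:
  "square_integrable f \<Longrightarrow> square_integrable (\<lambda>x. - f x)"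
  using square_integrable_cmult[of f "-1"] by simp

lemma square_integrable_diff:
  "square_integrable f \<Longrightarrow> square_integrable g \<Longrightarrow> square_integrable (\<lambda>x. f x - g x)"
  using square_integrable_add[OF _ square_integrable_uminus, of f g] by simp

quotient_type l2 = "real \<Rightarrow> complex" / partial: l2_eq
proof (rule part_equivpI)
  show "\<exists>f. l2_eq f f"
    using square_integrable_zero by (auto simp: l2_eq_def)
  show "symp l2_eq"
    by (auto simp: l2_eq_def symp_def elim: eventually_mono)
  show "transp l2_eq"
  proof (rule transpI)
    fix f g h assume "l2_eq f g" "l2_eq g h"
    moreover from this have "AE x in unit_measure. f x = h x"
      by (rule l2_eq_AE2) simp
    ultimately show "l2_eq f h" by (simp add: l2_eq_def)
  qed
qed

lift_definition scaleC_l2 :: "complex \<Rightarrow> l2 \<Rightarrow> l2" is "\<lambda>a f x. a * f x"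
  by (auto simp: l2_eq_def square_integrable_cmult elim: eventually_mono)

instantiation l2 :: real_inner
begin

lift_definition zero_l2 :: l2 is "\<lambda>x. 0"
  by (simp add: l2_eq_def square_integrable_zero)

lift_definition plus_l2 :: "l2 \<Rightarrow> l2 \<Rightarrow> l2" is "\<lambda>f g x. f x + g x"
proof -
  fix f f' g g' assume "l2_eq f f'" "l2_eq g g'"
  moreover from this have "AE x in unit_measure. f x + g x = f' x + g' x"
    by (rule l2_eq_AE2) simp
  ultimately show "l2_eq (\<lambda>x. f x + g x) (\<lambda>x. f' x + g' x)"
    by (simp add: l2_eq_def square_integrable_add)
qed

lift_definition uminus_l2 :: "l2 \<Rightarrow> l2" is "\<lambda>f x. - f x"
  by (auto simp: l2_eq_def square_integrable_uminus elim: eventually_mono)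

lift_definition minus_l2 :: "l2 \<Rightarrow> l2 \<Rightarrow> l2" is "\<lambda>f g x. f x - g x"
proof -
  fix f f' g g' assume "l2_eq f f'" "l2_eq g g'"
  moreover from this have "AE x in unit_measure. f x - g x = f' x - g' x"
    by (rule l2_eq_AE2) simp
  ultimately show "l2_eq (\<lambda>x. f x - g x) (\<lambda>x. f' x - g' x)"
    by (simp add: l2_eq_def square_integrable_diff)
qed

definition scaleR_l2 :: "real \<Rightarrow> l2 \<Rightarrow> l2" where
  "scaleR_l2 r f = scaleC_l2 (complex_of_real r) f"

text \<open>The real part of the complex inner product; it induces the usual L2 norm.\<close>

lift_definition inner_l2 :: "l2 \<Rightarrow> l2 \<Rightarrow> real" is
  "\<lambda>f g. Re (LINT x|unit_measure. f x * cnj (g x))"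
proof -
  fix f f' g g' assume e: "l2_eq f f'" "l2_eq g g'"
  note h = e[unfolded l2_eq_def]
  have "(LINT x|unit_measure. f x * cnj (g x)) = (LINT x|unit_measure. f' x * cnj (g' x))"
  proof (rule integral_cong_AE)
    show "(\<lambda>x. f x * cnj (g x)) \<in> borel_measurable unit_measure"
         "(\<lambda>x. f' x * cnj (g' x)) \<in> borel_measurable unit_measure"
      using h by (auto intro!: borel_measurable_integrable square_integrable_mult square_integrable_cnj)
    show "AE x in unit_measure. f x * cnj (g x) = f' x * cnj (g' x)"
      by (rule l2_eq_AE2[OF e]) simp
  qed
  then show "Re (LINT x|unit_measure. f x * cnj (g x)) = Re (LINT x|unit_measure. f' x * cnj (g' x))"
    by simp
qed

lift_definition norm_l2 :: "l2 \<Rightarrow> real" is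
  "\<lambda>f. sqrt (LINT x|unit_measure. (cmod (f x))\<^sup>2)"
proof -
  fix f f' assume e: "l2_eq f f'"
  note h = e[unfolded l2_eq_def]
  have "(LINT x|unit_measure. (cmod (f x))\<^sup>2) = (LINT x|unit_measure. (cmod (f' x))\<^sup>2)"
  proof (rule integral_cong_AE)
    show "(\<lambda>x. (cmod (f x))\<^sup>2) \<in> borel_measurable unit_measure"
         "(\<lambda>x. (cmod (f' x))\<^sup>2) \<in> borel_measurable unit_measure"
      using h by (auto simp: square_integrable_def)
    show "AE x in unit_measure. (cmod (f x))\<^sup>2 = (cmod (f' x))\<^sup>2"
      by (rule l2_eq_AE[OF e]) simp
  qed
  then show "sqrt (LINT x|unit_measure. (cmod (f x))\<^sup>2) = sqrt (LINT x|unit_measure. (cmod (f' x))\<^sup>2)"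
    by simp
qed

definition sgn_l2 :: "l2 \<Rightarrow> l2" where
  "sgn_l2 f = inverse (norm f) *\<^sub>R f"

definition dist_l2 :: "l2 \<Rightarrow> l2 \<Rightarrow> real" where
  "dist_l2 f g = norm (f - g)"

definition uniformity_l2 :: "(l2 \<times> l2) filter" where
  "uniformity_l2 = (INF e\<in>{0<..}. principal {(f, g). dist f g < e})"

definition open_l2 :: "l2 set \<Rightarrow> bool" where
  "open_l2 U \<longleftrightarrow> (\<forall>f\<in>U. eventually (\<lambda>(f', g). f' = f \<longrightarrow> g \<in> U) uniformity)"

instance
proof
  fix f g h :: l2 and r s :: real
  show "f + g + h = f + (g + h)"
    by transfer (simp add: l2_eq_def add.assoc square_integrable_add)
  show "f + g = g + f"
    by transfer (simp add: l2_eq_def add.commute square_integrable_add)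
  show "0 + f = f"
    by transfer (simp add: l2_eq_def)
  show "- f + f = 0"
    by transfer (simp add: l2_eq_def square_integrable_zero)
  show "f - g = f + - g"
    by transfer (simp add: l2_eq_def square_integrable_diff)
  show "r *\<^sub>R (f + g) = r *\<^sub>R f + r *\<^sub>R g"
    unfolding scaleR_l2_def
    by transfer (simp add: l2_eq_def distrib_left square_integrable_add square_integrable_cmult)
  show "(r + s) *\<^sub>R f = r *\<^sub>R f + s *\<^sub>R f"
    unfolding scaleR_l2_def
    by transfer (simp add: l2_eq_def distrib_right square_integrable_add square_integrable_cmult)
  show "r *\<^sub>R s *\<^sub>R f = (r * s) *\<^sub>R f"
    unfolding scaleR_l2_def
    by transfer (simp add: l2_eq_def mult.assoc square_integrable_cmult)
  show "1 *\<^sub>R f = f"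
    unfolding scaleR_l2_def by transfer (simp add: l2_eq_def)
  show "sgn f = inverse (norm f) *\<^sub>R f"
    by (rule sgn_l2_def)
  show "dist f g = norm (f - g)"
    by (rule dist_l2_def)
  show "(uniformity :: (l2 \<times> l2) filter) = (INF e\<in>{0<..}. principal {(f, g). dist f g < e})"
    by (rule uniformity_l2_def)
  show "open U \<longleftrightarrow> (\<forall>f\<in>U. eventually (\<lambda>(f', g). f' = f \<longrightarrow> g \<in> U) uniformity)" for U :: "l2 set"
    by (rule open_l2_def)
  show "inner f g = inner g f"
  proof transfer
    fix f g assume "l2_eq f f" "l2_eq g g"
    have "(LINT x|unit_measure. g x * cnj (f x)) = (LINT x|unit_measure. cnj (f x * cnj (g x)))"
      by (simp add: mult.commute)
    also have "\<dots> = cnj (LINT x|unit_measure. f x * cnj (g x))"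
      by (rule Bochner_Integration.integral_cnj)
    finally show "Re (LINT x|unit_measure. f x * cnj (g x)) = Re (LINT x|unit_measure. g x * cnj (f x))"
      by simp
  qed
  show "inner (f + g) h = inner f h + inner g h"
    by transfer
      (simp add: l2_eq_def distrib_right square_integrable_mult square_integrable_cnj)
  show "inner (r *\<^sub>R f) g = r * inner f g"
    unfolding scaleR_l2_def
    by transfer (simp add: l2_eq_def mult.assoc square_integrable_mult square_integrable_cnj)
  have inner_eq: "Re (LINT x|unit_measure. f x * cnj (f x)) = (LINT x|unit_measure. (cmod (f x))\<^sup>2)"
    for f
  proof -
    have "(LINT x|unit_measure. f x * cnj (f x)) =
        (LINT x|unit_measure. complex_of_real ((cmod (f x))\<^sup>2))"
      by (simp only: complex_norm_square)
    also have "\<dots> = complex_of_real (LINT x|unit_measure. (cmod (f x))\<^sup>2)"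
      by (rule integral_complex_of_real)
    finally show ?thesis by simp
  qed
  show "0 \<le> inner f f"
    by transfer (simp add: inner_eq)
  show "inner f f = 0 \<longleftrightarrow> f = 0"
  proof transfer
    fix f assume "l2_eq f f"
    then have sq: "square_integrable f" by (simp add: l2_eq_def)
    then have "(LINT x|unit_measure. (cmod (f x))\<^sup>2) = 0 \<longleftrightarrow> (AE x in unit_measure. (cmod (f x))\<^sup>2 = 0)"
      by (intro integral_nonneg_eq_0_iff_AE) (auto simp: square_integrable_def)
    then show "Re (LINT x|unit_measure. f x * cnj (f x)) = 0 \<longleftrightarrow> l2_eq f (\<lambda>x. 0)"
      using sq by (simp add: inner_eq l2_eq_def square_integrable_zero)
  qed
  show "norm f = sqrt (inner f f)"
    by transfer (simp add: inner_eq)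
qed

end


section \<open>Sobolev spaces on (0,1)\<close>

text \<open>
  One-dimensional Sobolev spaces as in Brezis, Functional Analysis, Sobolev Spaces and
  Partial Differential Equations, Chapter 8: the test functions are the continuously
  differentiable functions with compact support in (0,1).
\<close>

definition test_fun :: "(real \<Rightarrow> complex) \<Rightarrow> bool" where
  "test_fun \<phi> \<longleftrightarrow> \<phi> C1_differentiable_on UNIV \<and>
     compact (closure {x. \<phi> x \<noteq> 0}) \<and> closure {x. \<phi> x \<noteq> 0} \<subseteq> {0<..<1}"

abbreviation fun_deriv :: "(real \<Rightarrow> complex) \<Rightarrow> real \<Rightarrow> complex" where
  "fun_deriv \<phi> \<equiv> (\<lambda>x. vector_derivative \<phi> (at x))"

lemma test_fun_measurable:
  assumes "test_fun \<phi>"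
  shows "\<phi> \<in> borel_measurable unit_measure" "fun_deriv \<phi> \<in> borel_measurable unit_measure"
proof -
  obtain D where D: "\<And>x. (\<phi> has_vector_derivative D x) (at x)" "continuous_on UNIV D"
    using assms unfolding test_fun_def C1_differentiable_on_def by auto
  have "fun_deriv \<phi> = D"
    using D(1) vector_derivative_at by blast
  moreover have "continuous_on UNIV \<phi>"
    using D(1) has_vector_derivative_continuous continuous_at_imp_continuous_on by blast
  ultimately have "continuous_on {0<..<1} \<phi>" "continuous_on {0<..<1} (fun_deriv \<phi>)"
    using D(2) continuous_on_subset by blast+
  then show "\<phi> \<in> borel_measurable unit_measure" "fun_deriv \<phi> \<in> borel_measurable unit_measure"
    by (auto intro: continuous_imp_measurable_on_sets_lebesgue)
qed

lift_definition has_weak_deriv :: "l2 \<Rightarrow> l2 \<Rightarrow> bool" is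
  "\<lambda>f g. \<forall>\<phi>. test_fun \<phi> \<longrightarrow>
     (LINT x|unit_measure. f x * fun_deriv \<phi> x) = - (LINT x|unit_measure. g x * \<phi> x)"
proof -
  fix f f' g g' assume e: "l2_eq f f'" "l2_eq g g'"
  note h = e[unfolded l2_eq_def square_integrable_def]
  have "(LINT x|unit_measure. f x * fun_deriv \<phi> x) = (LINT x|unit_measure. f' x * fun_deriv \<phi> x)"
    if "test_fun \<phi>" for \<phi>
  proof (rule integral_cong_AE)
    show "AE x in unit_measure. f x * fun_deriv \<phi> x = f' x * fun_deriv \<phi> x"
      by (rule l2_eq_AE[OF e(1)]) simp
  qed (use h test_fun_measurable[OF that] in auto)
  moreover have "(LINT x|unit_measure. g x * \<phi> x) = (LINT x|unit_measure. g' x * \<phi> x)"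
    if "test_fun \<phi>" for \<phi>
  proof (rule integral_cong_AE)
    show "AE x in unit_measure. g x * \<phi> x = g' x * \<phi> x"
      by (rule l2_eq_AE[OF e(2)]) simp
  qed (use h test_fun_measurable[OF that] in auto)
  ultimately show "(\<forall>\<phi>. test_fun \<phi> \<longrightarrow>
      (LINT x|unit_measure. f x * fun_deriv \<phi> x) = - (LINT x|unit_measure. g x * \<phi> x)) =
    (\<forall>\<phi>. test_fun \<phi> \<longrightarrow>
      (LINT x|unit_measure. f' x * fun_deriv \<phi> x) = - (LINT x|unit_measure. g' x * \<phi> x))"
    by auto
qed

text \<open>Meaningful only on \<open>H1\<close>, where the weak derivative exists; it is unique in \<open>l2\<close>.\<close>

definition weak_deriv :: "l2 \<Rightarrow> l2" where
  "weak_deriv u = (THE g. has_weak_deriv u g)"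

definition H1 :: "l2 set" where
  "H1 = {u. \<exists>g. has_weak_deriv u g}"

text \<open>
  The closure of the test functions in the \<open>H1\<close> norm, written as a closure of graphs: convergence
  of \<open>(u, weak_deriv u)\<close> in \<open>l2 \<times> l2\<close> is convergence of \<open>u\<close> in \<open>H1\<close>.
\<close>

definition H1_0 :: "l2 set" where
  "H1_0 = {u \<in> H1. (u, weak_deriv u) \<in>
     closure ((\<lambda>\<phi>. (abs_l2 \<phi>, abs_l2 (fun_deriv \<phi>))) ` {\<phi>. test_fun \<phi>})}"

definition H2 :: "l2 set" where
  "H2 = {u \<in> H1. weak_deriv u \<in> H1}"


section \<open>The energy space and the operator\<close>

type_synonym state = "l2 \<times> l2 \<times> l2 \<times> l2"

definition energy_space :: "state set" where
  "energy_space = H1_0 \<times> UNIV \<times> H1_0 \<times> UNIV"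

fun energy_norm :: "state \<Rightarrow> real" where
  "energy_norm (u, v, y, z) =
     sqrt ((norm v)\<^sup>2 + (norm (weak_deriv u))\<^sup>2 + (norm z)\<^sup>2 + (norm (weak_deriv y))\<^sup>2)"

fun scaleC_state :: "complex \<Rightarrow> state \<Rightarrow> state" where
  "scaleC_state a (u, v, y, z) = (scaleC_l2 a u, scaleC_l2 a v, scaleC_l2 a y, scaleC_l2 a z)"

definition damping_coeff :: "real \<Rightarrow> real" where
  "damping_coeff x = (if x \<le> 1/2 then 0 else 1)"

lift_definition damping :: "l2 \<Rightarrow> l2" is "\<lambda>f x. complex_of_real (damping_coeff x) * f x"
proof -
  fix f f' assume e: "l2_eq f f'"
  have [measurable]: "(\<lambda>x. x) \<in> borel_measurable unit_measure"
    by (rule continuous_imp_measurable_on_sets_lebesgue) auto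
  have m: "(\<lambda>x. complex_of_real (damping_coeff x)) \<in> borel_measurable unit_measure"
    unfolding damping_coeff_def by measurable
  have "square_integrable (\<lambda>x. complex_of_real (damping_coeff x) * k x)"
    if "square_integrable k" for k
    by (rule square_integrable_bounded_mult[OF that m, of 1]) (simp add: damping_coeff_def)
  moreover have "AE x in unit_measure.
      complex_of_real (damping_coeff x) * f x = complex_of_real (damping_coeff x) * f' x"
    by (rule l2_eq_AE[OF e]) simp
  ultimately show "l2_eq (\<lambda>x. complex_of_real (damping_coeff x) * f x)
      (\<lambda>x. complex_of_real (damping_coeff x) * f' x)"
    using e by (simp add: l2_eq_def)
qed

definition wave_domain :: "state set" where
  "wave_domain = {(u, v, y, z) \<in> energy_space.
     y \<in> H2 \<inter> H1_0 \<and> v \<in> H1_0 \<and> z \<in> H1_0 \<and>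
     weak_deriv u + damping (weak_deriv v) \<in> H1}"

fun wave_operator :: "real \<Rightarrow> state \<Rightarrow> state" where
  "wave_operator c (u, v, y, z) =
     (v, weak_deriv (weak_deriv u + damping (weak_deriv v)) - c *\<^sub>R z,
      z, weak_deriv (weak_deriv y) + c *\<^sub>R v)"


section \<open>Semigroups on the energy space\<close>

text \<open>
  The topology of the energy space is that of \<open>energy_norm\<close>, not the product topology of the
  type \<open>state\<close>; hence limits are stated through \<open>energy_norm\<close>. Only the values of \<open>T t U\<close> with
  \<open>t \<ge> 0\<close> and \<open>U \<in> energy_space\<close> matter.
\<close>

definition C0_contraction_semigroup :: "(real \<Rightarrow> state \<Rightarrow> state) \<Rightarrow> bool" where
  "C0_contraction_semigroup T \<longleftrightarrow>
     (\<forall>t\<ge>0. \<forall>U\<in>energy_space. T t U \<in> energy_space) \<and>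
     (\<forall>t\<ge>0. \<forall>U\<in>energy_space. \<forall>V\<in>energy_space. T t (U + V) = T t U + T t V) \<and>
     (\<forall>t\<ge>0. \<forall>a. \<forall>U\<in>energy_space. T t (scaleC_state a U) = scaleC_state a (T t U)) \<and>
     (\<forall>t\<ge>0. \<forall>U\<in>energy_space. energy_norm (T t U) \<le> energy_norm U) \<and>
     (\<forall>U\<in>energy_space. T 0 U = U) \<and>
     (\<forall>s\<ge>0. \<forall>t\<ge>0. \<forall>U\<in>energy_space. T (s + t) U = T s (T t U)) \<and>
     (\<forall>U\<in>energy_space. ((\<lambda>t. energy_norm (T t U - U)) \<longlongrightarrow> 0) (at_right 0))"

definition has_generator_value :: "(real \<Rightarrow> state \<Rightarrow> state) \<Rightarrow> state \<Rightarrow> state \<Rightarrow> bool" where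
  "has_generator_value T U F \<longleftrightarrow> U \<in> energy_space \<and> F \<in> energy_space \<and>
     ((\<lambda>h. energy_norm ((1 / h) *\<^sub>R (T h U - U) - F)) \<longlongrightarrow> 0) (at_right 0)"

definition is_generator ::
    "state set \<Rightarrow> (state \<Rightarrow> state) \<Rightarrow> (real \<Rightarrow> state \<Rightarrow> state) \<Rightarrow> bool" where
  "is_generator D A T \<longleftrightarrow> (\<forall>U F. has_generator_value T U F \<longleftrightarrow> U \<in> D \<and> F = A U)"

definition exponentially_stable :: "(real \<Rightarrow> state \<Rightarrow> state) \<Rightarrow> bool" where
  "exponentially_stable T \<longleftrightarrow>
     (\<exists>M>0. \<exists>\<epsilon>>0. \<forall>t>0. \<forall>U\<in>energy_space.
        energy_norm (T t U) \<le> M * exp (- \<epsilon> * t) * energy_norm U)"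

end

theory Submission
  imports Defs
begin

text \<open>
  Exponential stability would give a bound \<open>\<parallel>U\<parallel> \<le> K \<parallel>(i\<omega> - A) U\<parallel>\<close> on the domain of the generator \<open>A\<close>,
  with \<open>K\<close> independent of the real number \<open>\<omega>\<close> (\<open>exponentially_stable_imp_resolvent_bound\<close>). This
  bound is violated by quasimodes (\<open>quasimode\<close>): for every odd multiple \<open>\<omega> \<ge> 2\<close> of \<open>\<pi>\<close> there is a
  state \<open>U\<close> whose residual \<open>(i\<omega> - A) U\<close> has norm \<open>O(\<surd>\<omega>)\<close>, whereas \<open>\<parallel>U\<parallel>\<close> is at least a constant
  times \<open>\<omega>\<close> when \<open>\<omega>\<close> is large.

  The quasimodes exist because the damping jumps at \<open>1/2\<close>. At high frequency the viscous right half
  is so stiff for the component \<open>u\<close> that the interface acts almost like a fixed end: the wave is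
  reflected, and only a boundary layer of thickness and relative amplitude \<open>\<omega>\<^sup>-\<^sup>1\<^sup>/\<^sup>2\<close> enters the
  damped half. In the limit nothing is dissipated. The limiting system is \<open>u\<close> on \<open>(0,1/2)\<close> with
  Dirichlet conditions, coupled there to \<open>y\<close>, which travels undamped on all of \<open>(0,1)\<close>. On the left
  half \<open>u + i y\<close> and \<open>u - i y\<close> decouple, with wave numbers close to \<open>\<omega> - c/2\<close> and \<open>\<omega> + c/2\<close>.
  Superposing the two sine waves gives \<open>u = - cos (\<omega>x) sin (cx/2)\<close> and
  \<open>y = - i sin (\<omega>x) cos (cx/2)\<close>. For \<open>\<omega>\<close> an odd multiple of \<open>\<pi>\<close> we have \<open>cos (\<omega>/2) = 0\<close>; then \<open>u\<close>
  vanishes at \<open>1/2\<close>, and \<open>y\<close> continues to the right as \<open>- i cos (c/4) sin (\<omega>x)\<close>, whatever the value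
  of \<open>c\<close>. Corrections of lower order make the state an exact element of the domain.

  To place these piecewise smooth functions in the domain, their pointwise derivatives have to be
  identified with \<open>weak_deriv\<close>. This rests on the uniqueness of weak derivatives
  (\<open>has_weak_deriv_unique\<close>), on integration by parts across the interface (\<open>has_weak_deriv_glue\<close>),
  and on the approximation of piecewise smooth functions with zero boundary values by test
  functions (\<open>glue_in_H1_0\<close>).
\<close>

section \<open>Representatives of elements of L2(0,1)\<close>

lemma l2_eq_refl: "square_integrable f \<Longrightarrow> l2_eq f f"
  by (simp add: l2_eq_def)

lemma abs_l2_eq_iff:
  assumes "square_integrable f" "square_integrable g"
  shows "abs_l2 f = abs_l2 g \<longleftrightarrow> (AE x in unit_measure. f x = g x)"
  using Quotient_rel[OF Quotient_l2, of f g] assms by (auto simp: l2_eq_def)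

lemma l2_exhaust:
  obtains f where "square_integrable f" "u = abs_l2 f"
  using l2.abs_induct[of "\<lambda>u. \<exists>f. square_integrable f \<and> u = abs_l2 f" u]
  by (auto simp: l2_eq_def)

lemmas abs_l2_simps =
  plus_l2.abs_eq[OF l2_eq_refl l2_eq_refl] minus_l2.abs_eq[OF l2_eq_refl l2_eq_refl]
  scaleC_l2.abs_eq[OF l2_eq_refl] norm_l2.abs_eq[OF l2_eq_refl] damping.abs_eq[OF l2_eq_refl]
  has_weak_deriv.abs_eq[OF l2_eq_refl l2_eq_refl]

lemma finite_measure_unit: "finite_measure unit_measure"
  by (rule finite_measure_lebesgue_on) simp

lemma measure_unit: "measure unit_measure (space unit_measure) = 1"
  by (simp add: measure_restrict_space)

lemma square_integrable_bounded:
  assumes "f \<in> borel_measurable unit_measure" "\<And>x. 0 < x \<Longrightarrow> x < 1 \<Longrightarrow> cmod (f x) \<le> B"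
  shows "square_integrable f"
  unfolding square_integrable_def
proof
  interpret finite_measure unit_measure by (rule finite_measure_unit)
  show "integrable unit_measure (\<lambda>x. (cmod (f x))\<^sup>2)"
  proof (rule integrable_const_bound[where B = "B\<^sup>2"])
    show "AE x in unit_measure. norm ((cmod (f x))\<^sup>2) \<le> B\<^sup>2"
      using assms(2) by (auto intro!: AE_I2 power_mono)
  qed (use assms in measurable)
qed fact

lemma norm_abs_l2_le:
  assumes "square_integrable f" "\<And>x. 0 < x \<Longrightarrow> x < 1 \<Longrightarrow> cmod (f x) \<le> B" "0 \<le> B"
  shows "norm (abs_l2 f) \<le> B"
proof -
  interpret finite_measure unit_measure by (rule finite_measure_unit)
  have "(LINT x|unit_measure. (cmod (f x))\<^sup>2) \<le> (LINT x|unit_measure. B\<^sup>2)"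
    using assms by (intro integral_mono) (auto simp: square_integrable_def intro!: power_mono)
  also have "\<dots> = B\<^sup>2" using measure_unit by simp
  finally show ?thesis
    using assms by (simp add: abs_l2_simps real_le_lsqrt)
qed

lemma square_integrable_imp_integrable:
  assumes "square_integrable f" shows "integrable unit_measure f"
proof -
  have "square_integrable (\<lambda>x. 1)" by (rule square_integrable_bounded[where B = 1]) auto
  from square_integrable_mult[OF assms this] show ?thesis by simp
qed

lemma scaleR_l2_eq: "r *\<^sub>R (f::l2) = scaleC_l2 (complex_of_real r) f"
  by (rule scaleR_l2_def)

lemma norm_scaleC_l2: "norm (scaleC_l2 a f) = cmod a * norm f"
  by transfer (simp add: norm_mult power_mult_distrib real_sqrt_mult)

lemma scaleC_l2_add: "scaleC_l2 a (f + g) = scaleC_l2 a f + scaleC_l2 a g"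
  by (cases f rule: l2_exhaust, cases g rule: l2_exhaust)
    (simp add: abs_l2_simps square_integrable_cmult square_integrable_add distrib_left)

lemma scaleC_l2_add_left: "scaleC_l2 (a + b) f = scaleC_l2 a f + scaleC_l2 b f"
  by (cases f rule: l2_exhaust)
    (simp add: abs_l2_simps square_integrable_cmult square_integrable_add distrib_right)

lemma scaleC_l2_scaleC: "scaleC_l2 a (scaleC_l2 b f) = scaleC_l2 (a * b) f"
  by (cases f rule: l2_exhaust)
    (simp add: abs_l2_simps square_integrable_cmult mult.assoc)

lemma scaleC_l2_one: "scaleC_l2 1 f = f"
  by (cases f rule: l2_exhaust) (simp add: abs_l2_simps)

lemma bounded_linear_scaleC_l2: "bounded_linear (scaleC_l2 a)"
proof (rule bounded_linear_intro)
  show "norm (scaleC_l2 a f) \<le> norm f * cmod a" for f by (simp add: norm_scaleC_l2)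
qed (simp_all add: scaleC_l2_add scaleR_l2_eq scaleC_l2_scaleC mult.commute)

section \<open>Uniqueness of the weak derivative\<close>

text \<open>
  Squaring removes the corner of \<open>max 0 x\<close>. Both the cutoff functions and the antiderivative of the
  hat function below are built from this \<open>C1\<close> function.
\<close>

lemma has_real_derivative_max_square:
  "((\<lambda>x. (max 0 x)\<^sup>2) has_real_derivative 2 * max 0 x) (at (x::real))"
proof (cases "x = 0")
  case True
  have "((\<lambda>h. (max 0 h)\<^sup>2 / h) \<longlongrightarrow> 0) (at (0::real))"
  proof (rule Lim_null_comparison)
    show "\<forall>\<^sub>F h in at 0. norm ((max 0 h)\<^sup>2 / h) \<le> \<bar>h\<bar>"
      by (rule always_eventually) (auto simp: max_def power2_eq_square)
    show "((\<lambda>h::real. \<bar>h\<bar>) \<longlongrightarrow> 0) (at 0)" by (auto intro!: tendsto_eq_intros)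
  qed
  then show ?thesis using True by (simp add: DERIV_def)
next
  case False
  consider "x > 0" | "x < 0" using False by linarith
  then show ?thesis
  proof cases
    case 1
    show ?thesis
    proof (rule has_field_derivative_transform_within_open[where S = "{0<..}"])
      show "((\<lambda>x. x\<^sup>2) has_real_derivative 2 * max 0 x) (at x)"
        using 1 by (auto intro!: derivative_eq_intros)
    qed (use 1 in auto)
  next
    case 2
    show ?thesis
    proof (rule has_field_derivative_transform_within_open[where S = "{..<0}"])
      show "((\<lambda>x. 0) has_real_derivative 2 * max 0 x) (at x)"
        using 2 by (auto intro!: derivative_eq_intros)
    qed (use 2 in auto)
  qed
qed

lemma test_funI:
  assumes d: "\<And>x. (\<phi> has_vector_derivative D x) (at x)" and "continuous_on UNIV D"
    and z: "\<And>x. \<phi> x \<noteq> 0 \<Longrightarrow> a \<le> x \<and> x \<le> b" and ab: "0 < a" "b < 1"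
  shows "test_fun \<phi>" "fun_deriv \<phi> = D"
proof -
  have "closure {x. \<phi> x \<noteq> 0} \<subseteq> {a..b}"
    by (rule closure_minimal) (use z in auto)
  moreover have "bounded {x. \<phi> x \<noteq> 0}"
    by (rule bounded_subset[of "{a..b}"]) (use z in auto)
  moreover have "\<phi> C1_differentiable_on UNIV"
    using assms(1,2) unfolding C1_differentiable_on_def by auto
  ultimately show "test_fun \<phi>"
    using ab unfolding test_fun_def by (auto simp: compact_closure)
  show "fun_deriv \<phi> = D"
    using d vector_derivative_at by blast
qed

lemma test_fun_square_integrable:
  assumes "test_fun \<phi>"
  shows "square_integrable \<phi>" "square_integrable (fun_deriv \<phi>)"
proof -
  obtain D where D: "\<And>x. (\<phi> has_vector_derivative D x) (at x)" "continuous_on UNIV D"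
    using assms unfolding test_fun_def C1_differentiable_on_def by auto
  have e: "fun_deriv \<phi> = D"
    using D(1) vector_derivative_at by blast
  have c: "continuous_on UNIV \<phi>"
    using D(1) has_vector_derivative_continuous continuous_at_imp_continuous_on by blast
  have sq: "square_integrable f" if f: "continuous_on UNIV f" for f
  proof -
    have "continuous_on {0..1} f" using f continuous_on_subset by blast
    then have "bounded (f ` {0..1})"
      by (intro compact_imp_bounded compact_continuous_image) auto
    then obtain B where "\<And>x. 0 \<le> x \<Longrightarrow> x \<le> 1 \<Longrightarrow> cmod (f x) \<le> B"
      unfolding bounded_iff by (metis atLeastAtMost_iff imageI)
    moreover have "f \<in> borel_measurable unit_measure"
      by (rule continuous_imp_measurable_on_sets_lebesgue) (use f continuous_on_subset in auto)
    ultimately show ?thesis by (intro square_integrable_bounded[of f B]) auto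
  qed
  show "square_integrable \<phi>" "square_integrable (fun_deriv \<phi>)"
    using sq c D(2) e by auto
qed

text \<open>
  As \<open>n\<close> grows, these functions \<open>k / (k + 1/n)\<close> increase to the indicator of \<open>(a, b)\<close>, because \<open>k\<close> is
  positive exactly there. They turn statements about test functions into statements about intervals.
\<close>

lemma interval_test_fun:
  fixes a b :: real and n :: nat
  assumes "0 < a" "b < 1"
  defines "k \<equiv> \<lambda>x. (max 0 (b - x))\<^sup>2 * (max 0 (x - a))\<^sup>2"
  shows "test_fun (\<lambda>x. complex_of_real (real n * k x / (1 + real n * k x)))"
proof -
  have k0: "0 \<le> k x" for x by (simp add: k_def)
  have pos: "1 + real n * k x > 0" for x using k0[of x] by (simp add: add_pos_nonneg)
  define k' where "k' x = - 2 * max 0 (b - x) * (max 0 (x - a))\<^sup>2 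
      + (max 0 (b - x))\<^sup>2 * (2 * max 0 (x - a))" for x
  have 1: "((\<lambda>x. (max 0 (b - x))\<^sup>2) has_real_derivative - 2 * max 0 (b - x)) (at x)" for x
  proof -
    have "((\<lambda>x. b - x) has_real_derivative -1) (at x)"
      by (auto intro!: derivative_eq_intros)
    from DERIV_chain2[OF has_real_derivative_max_square this] show ?thesis by simp
  qed
  have 2: "((\<lambda>x. (max 0 (x - a))\<^sup>2) has_real_derivative 2 * max 0 (x - a)) (at x)" for x
  proof -
    have "((\<lambda>x. x - a) has_real_derivative 1) (at x)"
      by (auto intro!: derivative_eq_intros)
    from DERIV_chain2[OF has_real_derivative_max_square this] show ?thesis by simp
  qed
  have dk: "(k has_real_derivative k' x) (at x)" for x
    unfolding k_def k'_def by (rule derivative_eq_intros 1 2 refl)+ (simp add: algebra_simps)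
  define D where "D x = real n * k' x / (1 + real n * k x)\<^sup>2" for x
  have "((\<lambda>x. real n * k x / (1 + real n * k x)) has_real_derivative D x) (at x)" for x
    unfolding D_def
    by (rule derivative_eq_intros dk refl)+
      (use pos[of x] in \<open>auto simp: field_simps power2_eq_square\<close>)
  then have d: "((\<lambda>x. complex_of_real (real n * k x / (1 + real n * k x)))
      has_vector_derivative complex_of_real (D x)) (at x)" for x
    by (rule has_vector_derivative_of_real)
  have c: "continuous_on UNIV (\<lambda>x. complex_of_real (D x))"
    unfolding D_def k'_def k_def
    by (intro continuous_intros) (use pos in \<open>auto simp: k_def less_imp_neq[symmetric]\<close>)
  show ?thesis
    by (rule test_funI(1)[OF d c, where a = a and b = b]) (use assms in \<open>auto simp: k_def max_def split: if_splits\<close>)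
qed

lemma sets_unit_indicator:
  assumes "A \<in> sets lebesgue"
  shows "indicator A \<in> borel_measurable unit_measure"
  by (rule measurable_restrict_space1) (use assms in measurable)

text \<open>
  The endpoints are arbitrary reals, so the approximating intervals must also shrink away from \<open>0\<close>
  and \<open>1\<close> to keep the supports compact in \<open>(0,1)\<close>.
\<close>

lemma integral_interval_eq_0:
  fixes d :: "real \<Rightarrow> complex"
  assumes d: "integrable unit_measure d"
    and 0: "\<And>\<phi>. test_fun \<phi> \<Longrightarrow> (LINT x|unit_measure. d x * \<phi> x) = 0"
  shows "(LINT x|unit_measure. indicator {a<..<b} x *\<^sub>R d x) = 0"
proof -
  define l where "l n = max a 0 + 1 / (real n + 1)" for n
  define r where "r n = min b 1 - 1 / (real n + 1)" for n
  define k where "k n x = (max 0 (r n - x))\<^sup>2 * (max 0 (x - l n))\<^sup>2" for n x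
  define kk where "kk x = (max 0 (min b 1 - x))\<^sup>2 * (max 0 (x - max a 0))\<^sup>2" for x
  define \<phi> where "\<phi> n x = complex_of_real (real n * k n x / (1 + real n * k n x))" for n x
  have k0: "0 \<le> k n x" for n x by (simp add: k_def)
  have pos: "1 + real n * k n x > 0" for n x using k0[of n x] by (simp add: add_pos_nonneg)
  have lr: "max a 0 < l n" "r n < min b 1" for n
  proof -
    have "0 < 1 / (real n + 1)" by (simp add: add_nonneg_pos)
    then show "max a 0 < l n" "r n < min b 1" unfolding l_def r_def by linarith+
  qed
  have t: "test_fun (\<phi> n)" for n
    using interval_test_fun[of "l n" "r n" n] lr[of n] unfolding \<phi>_def k_def by simp
  have klim: "(\<lambda>n. k n x) \<longlonglongrightarrow> kk x" for x
  proof -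
    have s: "(\<lambda>n. 1 / (real n + 1)) \<longlonglongrightarrow> 0" by real_asymp
    have "(\<lambda>n. k n x) \<longlonglongrightarrow> (max 0 (min b 1 - 0 - x))\<^sup>2 * (max 0 (x - (max a 0 + 0)))\<^sup>2"
      unfolding k_def l_def r_def by (intro tendsto_intros s)
    then show ?thesis by (simp add: kk_def)
  qed
  have lim1: "((\<lambda>y::real. y / (1 + y)) \<longlongrightarrow> 1) at_top" by real_asymp
  have "(\<lambda>n. LINT x|unit_measure. d x * \<phi> n x) \<longlonglongrightarrow> 
      (LINT x|unit_measure. indicator {a<..<b} x *\<^sub>R d x)"
  proof (rule integral_dominated_convergence[where w = "\<lambda>x. cmod (d x)"])
    show "AE x in unit_measure. (\<lambda>n. d x * \<phi> n x) \<longlonglongrightarrow> indicator {a<..<b} x *\<^sub>R d x"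
    proof (rule AE_I2)
      fix x assume "x \<in> space unit_measure"
      then have x: "0 < x" "x < 1" by auto
      show "(\<lambda>n. d x * \<phi> n x) \<longlonglongrightarrow> indicator {a<..<b} x *\<^sub>R d x"
      proof (cases "a < x \<and> x < b")
        case True
        then have "kk x > 0" using x by (auto simp: kk_def intro!: mult_pos_pos)
        then have "filterlim (\<lambda>n. k n x * real n) at_top sequentially"
          by (intro filterlim_tendsto_pos_mult_at_top[OF klim] filterlim_real_sequentially)
        from filterlim_compose[OF lim1 this]
        have "(\<lambda>n. real n * k n x / (1 + real n * k n x)) \<longlonglongrightarrow> 1" 
          by (simp add: mult.commute)
        then have "(\<lambda>n. \<phi> n x) \<longlonglongrightarrow> complex_of_real 1"
          unfolding \<phi>_def by (rule tendsto_of_real)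
        then have "(\<lambda>n. d x * \<phi> n x) \<longlonglongrightarrow> d x * complex_of_real 1"
          by (intro tendsto_intros)
        then show ?thesis using True by simp
      next
        case False
        then have "k n x = 0" for n using lr[of n] by (auto simp: k_def)
        then show ?thesis using False by (auto simp: \<phi>_def)
      qed
    qed
    show "AE x in unit_measure. cmod (d x * \<phi> n x) \<le> cmod (d x)" for n
    proof (rule AE_I2)
      fix x
      have "\<bar>real n * k n x / (1 + real n * k n x)\<bar> \<le> 1"
        using k0[of n x] pos[of n x] by (simp add: field_simps)
      then show "cmod (d x * \<phi> n x) \<le> cmod (d x)"
        unfolding \<phi>_def norm_mult norm_of_real by (intro mult_left_le) auto
    qed
    show "(\<lambda>x. indicator {a<..<b} x *\<^sub>R d x) \<in> borel_measurable unit_measure"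
      by (intro borel_measurable_scaleR sets_unit_indicator borel_measurable_integrable d) simp
  qed (use d test_fun_measurable[OF t] in auto)
  then show ?thesis using 0[OF t] by (simp add: LIMSEQ_const_iff)
qed

text \<open>
  The fundamental lemma of the calculus of variations. Integrals over open intervals vanish by the
  previous lemma; a Dynkin-system argument extends this to Borel sets, and Lebesgue measurable sets
  differ from Borel sets by null sets.
\<close>

lemma AE_eq_0_if_orthogonal_test_funs:
  fixes d :: "real \<Rightarrow> complex"
  assumes d: "integrable unit_measure d"
    and 0: "\<And>\<phi>. test_fun \<phi> \<Longrightarrow> (LINT x|unit_measure. d x * \<phi> x) = 0"
  shows "AE x in unit_measure. d x = 0"
proof -
  interpret finite_measure unit_measure by (rule finite_measure_unit)
  let ?I = "\<lambda>A. LINT x|unit_measure. indicator A x *\<^sub>R d x"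
  have int: "integrable unit_measure (\<lambda>x. indicator A x *\<^sub>R d x)" if "A \<in> sets lebesgue" for A
  proof (rule Bochner_Integration.integrable_bound[OF d])
    show "(\<lambda>x. indicator A x *\<^sub>R d x) \<in> borel_measurable unit_measure"
      by (intro borel_measurable_scaleR sets_unit_indicator that borel_measurable_integrable d)
  qed (simp add: indicator_def)
  have "?I UNIV = 0"
  proof -
    have "?I UNIV = ?I {0<..<1}"
      by (rule Bochner_Integration.integral_cong) auto
    then show ?thesis using integral_interval_eq_0[OF d 0, of 0 1] by simp
  qed
  define G where "G = range (\<lambda>(a, b). {a<..<b::real})"
  have sG: "sets borel = sigma_sets UNIV G"
    unfolding borel_eq_box G_def box_real by simp
  have borel: "?I A = 0" if "A \<in> sets borel" for A
  proof -
    have "Int_stable G"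
      by (auto simp: Int_stable_def G_def Int_greaterThanLessThan)
    moreover have "G \<subseteq> Pow UNIV" by simp
    moreover have "A \<in> sigma_sets UNIV G"
      using that sG by simp
    ultimately show ?thesis
    proof (induction rule: sigma_sets_induct_disjoint)
      case (basic A)
      then show ?case using integral_interval_eq_0[OF d 0] by (auto simp: G_def)
    next
      case empty
      then show ?case by simp
    next
      case (compl A)
      have A: "A \<in> sets lebesgue"
        using compl(1) sG by simp
      have "?I (UNIV - A) = (LINT x|unit_measure. indicator UNIV x *\<^sub>R d x - indicator A x *\<^sub>R d x)"
        by (intro Bochner_Integration.integral_cong) (auto simp: indicator_def)
      also have "\<dots> = ?I UNIV - ?I A"
        by (intro Bochner_Integration.integral_diff int A) simp
      finally show ?case using compl \<open>?I UNIV = 0\<close> by simp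
    next
      case (union A)
      have A: "A i \<in> sets lebesgue" for i
        using union(2) sG by (metis rangeI sets_completionI_sets sets_lborel subsetD)
      have "(\<lambda>n. ?I (\<Union>i<n. A i)) \<longlonglongrightarrow> ?I (\<Union>i. A i)"
      proof (rule integral_dominated_convergence[where w = "\<lambda>x. cmod (d x)"])
        show "AE x in unit_measure. (\<lambda>n. indicator (\<Union>i<n. A i) x *\<^sub>R d x)
            \<longlonglongrightarrow> indicator (\<Union>i. A i) x *\<^sub>R d x"
          by (intro AE_I2 tendsto_scaleR LIMSEQ_indicator_UN tendsto_const)
        show "AE x in unit_measure. norm (indicator (\<Union>i<n. A i) x *\<^sub>R d x) \<le> cmod (d x)" for n
          by (auto simp: indicator_def)
      qed (use d A int in auto)
      moreover have "?I (\<Union>i<n. A i) = 0" for n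
      proof (induction n)
        case (Suc n)
        have "?I (\<Union>i<Suc n. A i) = (LINT x|unit_measure. indicator (\<Union>i<n. A i) x *\<^sub>R d x + indicator (A n) x *\<^sub>R d x)"
        proof (rule Bochner_Integration.integral_cong)
          fix x
          have un: "(\<Union>i<Suc n. A i) = (\<Union>i<n. A i) \<union> A n"
            by (simp add: lessThan_Suc Un_commute)
          have "A i \<inter> A n = {}" if "i < n" for i
            by (rule disjoint_family_onD[OF union(1)]) (use that in simp_all)
          then have dj: "(\<Union>i<n. A i) \<inter> A n = {}" by blast
          have "indicator (\<Union>i<Suc n. A i) x = (indicator (\<Union>i<n. A i) x + indicator (A n) x :: real)"
            unfolding un by (rule indicator_add[OF dj, symmetric])
          then show "indicator (\<Union>i<Suc n. A i) x *\<^sub>R d x = 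
              indicator (\<Union>i<n. A i) x *\<^sub>R d x + indicator (A n) x *\<^sub>R d x"
            by (simp only: scaleR_left_distrib)
        qed simp
        also have "\<dots> = ?I (\<Union>i<n. A i) + ?I (A n)"
          by (intro Bochner_Integration.integral_add int) (use A in auto)
        finally show ?case using Suc union(3) by simp
      qed simp
      ultimately show ?case by (simp add: LIMSEQ_const_iff)
    qed
  qed
  show ?thesis
  proof (rule density_zero[OF d])
    fix A assume "A \<in> sets unit_measure"
    then have "A \<in> sets lebesgue" by (auto simp: sets_restrict_space)
    then obtain S N N' where A: "A = S \<union> N" "N \<subseteq> N'" "N' \<in> null_sets lborel" "S \<in> sets lborel"
      by (rule sets_completionE)
    then have "N \<in> null_sets lebesgue" 
      by (meson null_sets_completionI null_sets_completion_subset)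
    then have "AE x in lebesgue. x \<notin> N" by (rule AE_not_in)
    then have "AE x in unit_measure. x \<notin> N"
      by (auto simp: AE_restrict_space_iff elim!: eventually_mono)
    then have "AE x in unit_measure. indicator A x *\<^sub>R d x = indicator S x *\<^sub>R d x"
      by eventually_elim (auto simp: A indicator_def)
    then have "?I A = ?I S"
      using int[of A] int[of S] \<open>A \<in> sets lebesgue\<close> A(4) by (intro integral_cong_AE) auto
    then show "set_lebesgue_integral unit_measure A d = 0"
      using borel[of S] A(4) by (simp add: set_lebesgue_integral_def)
  qed
qed

lemma has_weak_deriv_unique:
  assumes "has_weak_deriv u g" "has_weak_deriv u h"
  shows "g = h"
proof -
  obtain u' g' h' where sq: "square_integrable u'" "square_integrable g'" "square_integrable h'"
    and eq: "u = abs_l2 u'" "g = abs_l2 g'" "h = abs_l2 h'"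
    by (cases u rule: l2_exhaust, cases g rule: l2_exhaust, cases h rule: l2_exhaust) blast
  have "AE x in unit_measure. g' x - h' x = 0"
  proof (rule AE_eq_0_if_orthogonal_test_funs)
    show "integrable unit_measure (\<lambda>x. g' x - h' x)"
      using sq by (intro Bochner_Integration.integrable_diff square_integrable_imp_integrable)
    fix \<phi> assume t: "test_fun \<phi>"
    have p: "square_integrable \<phi>"
      by (rule test_fun_square_integrable(1)[OF t])
    have "(LINT x|unit_measure. g' x * \<phi> x) = (LINT x|unit_measure. h' x * \<phi> x)"
      using assms t sq by (simp add: eq abs_l2_simps)
    then show "(LINT x|unit_measure. (g' x - h' x) * \<phi> x) = 0"
      using sq p by (simp add: left_diff_distrib square_integrable_mult)
  qed
  then show ?thesis using sq by (simp add: eq abs_l2_eq_iff)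
qed

section \<open>Linearity of the weak derivative and of the space H1_0\<close>

lemma weak_derivI: "has_weak_deriv u g \<Longrightarrow> weak_deriv u = g"
  unfolding weak_deriv_def using has_weak_deriv_unique by blast

lemma H1I: "has_weak_deriv u g \<Longrightarrow> u \<in> H1"
  by (auto simp: H1_def)

lemma H1_weak_deriv: "u \<in> H1 \<Longrightarrow> has_weak_deriv u (weak_deriv u)"
  using weak_derivI by (auto simp: H1_def)

lemma has_weak_deriv_add:
  assumes "has_weak_deriv u g" "has_weak_deriv v h"
  shows "has_weak_deriv (u + v) (g + h)"
proof -
  obtain u' g' v' h' where sq: "square_integrable u'" "square_integrable g'" 
      "square_integrable v'" "square_integrable h'"
    and eq: "u = abs_l2 u'" "g = abs_l2 g'" "v = abs_l2 v'" "h = abs_l2 h'"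
    by (cases u rule: l2_exhaust, cases g rule: l2_exhaust, cases v rule: l2_exhaust, 
        cases h rule: l2_exhaust) blast
  show ?thesis
    using assms sq test_fun_square_integrable
    by (simp add: eq abs_l2_simps square_integrable_add distrib_right square_integrable_mult)
qed

lemma has_weak_deriv_scaleC:
  assumes "has_weak_deriv u g"
  shows "has_weak_deriv (scaleC_l2 a u) (scaleC_l2 a g)"
proof -
  obtain u' g' where sq: "square_integrable u'" "square_integrable g'" 
    and eq: "u = abs_l2 u'" "g = abs_l2 g'" 
    by (cases u rule: l2_exhaust, cases g rule: l2_exhaust) blast
  show ?thesis
    using assms sq by (simp add: eq abs_l2_simps square_integrable_cmult mult.assoc)
qed

lemma weak_deriv_add: "u \<in> H1 \<Longrightarrow> v \<in> H1 \<Longrightarrow> weak_deriv (u + v) = weak_deriv u + weak_deriv v"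
  by (intro weak_derivI has_weak_deriv_add H1_weak_deriv)

lemma weak_deriv_scaleC: "u \<in> H1 \<Longrightarrow> weak_deriv (scaleC_l2 a u) = scaleC_l2 a (weak_deriv u)"
  by (intro weak_derivI has_weak_deriv_scaleC H1_weak_deriv)

definition test_graph :: "(l2 \<times> l2) set" where
  "test_graph = (\<lambda>\<phi>. (abs_l2 \<phi>, abs_l2 (fun_deriv \<phi>))) ` {\<phi>. test_fun \<phi>}"

lemma H1_0_iff: "u \<in> H1_0 \<longleftrightarrow> u \<in> H1 \<and> (u, weak_deriv u) \<in> closure test_graph"
  by (simp add: H1_0_def test_graph_def)

lemma H1_0_imp_H1: "u \<in> H1_0 \<Longrightarrow> u \<in> H1"
  by (simp add: H1_0_iff)

lemma test_fun_combination:
  assumes "test_fun \<phi>" "test_fun \<psi>"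
  shows "test_fun (\<lambda>x. a * \<phi> x + b * \<psi> x)"
    "fun_deriv (\<lambda>x. a * \<phi> x + b * \<psi> x) = (\<lambda>x. a * fun_deriv \<phi> x + b * fun_deriv \<psi> x)"
proof -
  have vd: "\<And>x. (\<phi> has_vector_derivative fun_deriv \<phi> x) (at x)" 
      "\<And>x. (\<psi> has_vector_derivative fun_deriv \<psi> x) (at x)"
    and C1: "\<phi> C1_differentiable_on UNIV" "\<psi> C1_differentiable_on UNIV"
    using assms unfolding test_fun_def C1_differentiable_on_eq vector_derivative_works[symmetric]
    by auto
  have "((\<lambda>x. a * \<phi> x + b * \<psi> x) has_vector_derivative a * fun_deriv \<phi> x + b * fun_deriv \<psi> x) (at x)" for x
    by (intro has_vector_derivative_add has_vector_derivative_mult_right vd)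
  then show "fun_deriv (\<lambda>x. a * \<phi> x + b * \<psi> x) = (\<lambda>x. a * fun_deriv \<phi> x + b * fun_deriv \<psi> x)"
    using vector_derivative_at by blast
  have "{x. a * \<phi> x + b * \<psi> x \<noteq> 0} \<subseteq> closure {x. \<phi> x \<noteq> 0} \<union> closure {x. \<psi> x \<noteq> 0}"
  proof -
    have "{x. a * \<phi> x + b * \<psi> x \<noteq> 0} \<subseteq> {x. \<phi> x \<noteq> 0} \<union> {x. \<psi> x \<noteq> 0}" by auto
    also have "\<dots> \<subseteq> closure {x. \<phi> x \<noteq> 0} \<union> closure {x. \<psi> x \<noteq> 0}"
      by (intro Un_mono closure_subset)
    finally show ?thesis .
  qed
  then have sub: "closure {x. a * \<phi> x + b * \<psi> x \<noteq> 0} \<subseteq> closure {x. \<phi> x \<noteq> 0} \<union> closure {x. \<psi> x \<noteq> 0}"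
    by (rule closure_minimal) auto
  have "compact (closure {x. \<phi> x \<noteq> 0} \<union> closure {x. \<psi> x \<noteq> 0})"
    using assms by (auto simp: test_fun_def)
  then have "bounded (closure {x. a * \<phi> x + b * \<psi> x \<noteq> 0})"
    by (rule bounded_subset[OF compact_imp_bounded sub])
  then have "compact (closure {x. a * \<phi> x + b * \<psi> x \<noteq> 0})"
    by (simp add: compact_eq_bounded_closed)
  moreover have "(\<lambda>x. a * \<phi> x + b * \<psi> x) C1_differentiable_on UNIV"
    by (intro C1_differentiable_on_add C1_differentiable_on_mult C1 C1_differentiable_on_const)
  ultimately show "test_fun (\<lambda>x. a * \<phi> x + b * \<psi> x)"
    using assms sub unfolding test_fun_def by blast
qed

lemma test_graph_combination:
  assumes "(u, g) \<in> test_graph" "(v, h) \<in> test_graph"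
  shows "(scaleC_l2 a u + scaleC_l2 b v, scaleC_l2 a g + scaleC_l2 b h) \<in> test_graph"
proof -
  obtain \<phi> \<psi> where t: "test_fun \<phi>" "test_fun \<psi>"
    and eq: "u = abs_l2 \<phi>" "g = abs_l2 (fun_deriv \<phi>)" "v = abs_l2 \<psi>" "h = abs_l2 (fun_deriv \<psi>)"
    using assms by (auto simp: test_graph_def)
  note sq = test_fun_square_integrable[OF t(1)] test_fun_square_integrable[OF t(2)]
  have "scaleC_l2 a u + scaleC_l2 b v = abs_l2 (\<lambda>x. a * \<phi> x + b * \<psi> x)"
    "scaleC_l2 a g + scaleC_l2 b h = abs_l2 (fun_deriv (\<lambda>x. a * \<phi> x + b * \<psi> x))"
    by (simp_all add: eq sq abs_l2_simps square_integrable_cmult test_fun_combination[OF t])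
  then show ?thesis
    using test_fun_combination(1)[OF t] by (auto simp: test_graph_def)
qed

lemma H1_0_combination:
  assumes "u \<in> H1_0" "v \<in> H1_0"
  shows "scaleC_l2 a u + scaleC_l2 b v \<in> H1_0"
proof -
  have H: "u \<in> H1" "v \<in> H1" using assms H1_0_imp_H1 by auto
  have wd: "has_weak_deriv (scaleC_l2 a u + scaleC_l2 b v) 
      (scaleC_l2 a (weak_deriv u) + scaleC_l2 b (weak_deriv v))"
    by (intro has_weak_deriv_add has_weak_deriv_scaleC H1_weak_deriv H)
  obtain p q where p: "\<And>n. p n \<in> test_graph" "p \<longlonglongrightarrow> (u, weak_deriv u)"
    and q: "\<And>n. q n \<in> test_graph" "q \<longlonglongrightarrow> (v, weak_deriv v)"
    using assms unfolding H1_0_iff closure_sequential by blast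
  define s where "s n = (scaleC_l2 a (fst (p n)) + scaleC_l2 b (fst (q n)),
      scaleC_l2 a (snd (p n)) + scaleC_l2 b (snd (q n)))" for n
  have "s n \<in> test_graph" for n
    using test_graph_combination[of "fst (p n)" "snd (p n)" "fst (q n)" "snd (q n)"] p(1) q(1)
    by (simp add: s_def)
  moreover have "s \<longlonglongrightarrow> (scaleC_l2 a u + scaleC_l2 b v, 
      scaleC_l2 a (weak_deriv u) + scaleC_l2 b (weak_deriv v))"
    unfolding s_def
    using tendsto_fst[OF p(2)] tendsto_snd[OF p(2)] tendsto_fst[OF q(2)] tendsto_snd[OF q(2)]
    by (intro tendsto_Pair tendsto_add bounded_linear.tendsto[OF bounded_linear_scaleC_l2]) simp_all
  ultimately show ?thesis
    using H1I[OF wd] weak_derivI[OF wd] unfolding H1_0_iff closure_sequential by auto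
qed

section \<open>Functions glued from two C1 pieces\<close>

definition C1_with_deriv :: "(real \<Rightarrow> complex) \<Rightarrow> (real \<Rightarrow> complex) \<Rightarrow> bool" where
  "C1_with_deriv f g \<longleftrightarrow> (\<forall>x. (f has_vector_derivative g x) (at x)) \<and> continuous_on UNIV g"

lemma C1_with_deriv_continuous: "C1_with_deriv f g \<Longrightarrow> continuous_on A f"
  unfolding C1_with_deriv_def
  by (intro continuous_at_imp_continuous_on ballI has_vector_derivative_continuous) blast

lemma C1_with_deriv_mult:
  assumes "C1_with_deriv f g" "C1_with_deriv \<phi> \<psi>"
  shows "C1_with_deriv (\<lambda>x. f x * \<phi> x) (\<lambda>x. f x * \<psi> x + g x * \<phi> x)"
proof -
  have "((\<lambda>x. f x * \<phi> x) has_vector_derivative f x * \<psi> x + g x * \<phi> x) (at x)" for x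
    using assms by (intro has_vector_derivative_mult) (simp_all add: C1_with_deriv_def)
  moreover have "continuous_on UNIV (\<lambda>x. f x * \<psi> x + g x * \<phi> x)"
    using assms C1_with_deriv_continuous[OF assms(1)] C1_with_deriv_continuous[OF assms(2)]
    by (intro continuous_on_add continuous_on_mult) (simp_all add: C1_with_deriv_def)
  ultimately show ?thesis by (simp add: C1_with_deriv_def)
qed

text \<open>
  Both pieces are defined on the whole line, which keeps differentiability at the interface
  two-sided. The interface belongs to the left piece, as in \<open>damping_coeff\<close>, so that damping a glued
  function just replaces its left piece by \<open>0\<close>.
\<close>

definition glue :: "(real \<Rightarrow> complex) \<Rightarrow> (real \<Rightarrow> complex) \<Rightarrow> real \<Rightarrow> complex" where
  "glue f1 f2 = (\<lambda>x. if x \<le> 1/2 then f1 x else f2 x)"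

lemma continuous_on_glue:
  assumes "continuous_on UNIV f1" "continuous_on UNIV f2" "f1 (1/2) = f2 (1/2)"
  shows "continuous_on A (glue f1 f2)"
proof -
  have eq: "f1 x = f2 x" if "x \<le> 1/2" "1/2 \<le> x" for x
  proof -
    have "x = 1/2" using that by (rule order_antisym)
    show ?thesis unfolding \<open>x = 1/2\<close> by fact
  qed
  have "continuous_on ({..1/2} \<union> {1/2..}) (\<lambda>x. if x \<le> 1/2 then f1 x else f2 x)"
    using continuous_on_subset[OF assms(1) subset_UNIV] continuous_on_subset[OF assms(2) subset_UNIV]
    by (intro continuous_on_cases) (auto intro: eq)
  then have "continuous_on ({..1/2} \<union> {1/2..}) (glue f1 f2)" unfolding glue_def .
  then show ?thesis by (rule continuous_on_subset) auto
qed

lemma glue_measurable: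
  assumes "continuous_on UNIV f1" "continuous_on UNIV f2"
  shows "glue f1 f2 \<in> borel_measurable unit_measure"
proof -
  have [measurable]: "f1 \<in> borel_measurable borel" "f2 \<in> borel_measurable borel"
    using assms by (auto intro: borel_measurable_continuous_onI)
  have "glue f1 f2 \<in> borel_measurable borel"
    unfolding glue_def by measurable
  then have "glue f1 f2 \<in> borel_measurable lebesgue"
    by (intro measurable_completion) simp
  then show ?thesis by (rule measurable_restrict_space1)
qed

lemma glue_bounded:
  assumes "continuous_on UNIV f1" "continuous_on UNIV f2"
  obtains B where "B > 0" "\<And>x. 0 \<le> x \<Longrightarrow> x \<le> 1 \<Longrightarrow> cmod (glue f1 f2 x) \<le> B"
proof -
  have "\<exists>B. \<forall>x\<in>{0..1}. cmod (f x) \<le> B" if "continuous_on UNIV f" for f :: "real \<Rightarrow> complex"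
  proof -
    have "bounded (f ` {0..1})"
      by (intro compact_imp_bounded compact_continuous_image) (use continuous_on_subset[OF that] in auto)
    then show ?thesis by (auto simp: bounded_iff)
  qed
  then obtain B1 B2 where "\<forall>x\<in>{0..1}. cmod (f1 x) \<le> B1" "\<forall>x\<in>{0..1}. cmod (f2 x) \<le> B2"
    using assms by metis
  then show ?thesis
    by (intro that[of "max 1 (max B1 B2)"]) (auto simp: glue_def le_max_iff_disj)
qed

lemma square_integrable_glue:
  assumes "continuous_on UNIV f1" "continuous_on UNIV f2"
  shows "square_integrable (glue f1 f2)"
proof -
  obtain B where "B > 0" "\<And>x. 0 \<le> x \<Longrightarrow> x \<le> 1 \<Longrightarrow> cmod (glue f1 f2 x) \<le> B"
    using glue_bounded[OF assms] by blast
  then show ?thesis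
    by (intro square_integrable_bounded[of _ B] glue_measurable assms) auto
qed

lemma glue_has_integral:
  assumes "C1_with_deriv f1 g1" "C1_with_deriv f2 g2" "f1 (1/2) = f2 (1/2)" "a \<le> b"
  shows "(glue g1 g2 has_integral glue f1 f2 b - glue f1 f2 a) {a..b}"
proof -
  have cont: "continuous_on {a..b} (glue f1 f2)"
    by (intro continuous_on_glue C1_with_deriv_continuous[OF assms(1)] 
        C1_with_deriv_continuous[OF assms(2)] assms)
  have der: "(glue f1 f2 has_vector_derivative glue g1 g2 x) (at x)" if x: "x \<in> {a<..<b} - {1/2}" for x
  proof (cases "x < 1/2")
    case True
    then have "(f1 has_vector_derivative glue g1 g2 x) (at x)"
      using assms(1) by (simp add: glue_def C1_with_deriv_def)
    then show ?thesis
      by (rule has_vector_derivative_transform_within_open[of _ _ _ "{..<1/2}"])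
        (use True in \<open>auto simp: glue_def\<close>)
  next
    case False
    then have "(f2 has_vector_derivative glue g1 g2 x) (at x)"
      using assms(2) x by (simp add: glue_def C1_with_deriv_def)
    then show ?thesis
      by (rule has_vector_derivative_transform_within_open[of _ _ _ "{1/2<..}"])
        (use False x in \<open>auto simp: glue_def\<close>)
  qed
  show ?thesis
    by (rule fundamental_theorem_of_calculus_interior_strong[of "{1/2}" a b "glue f1 f2" "glue g1 g2",
          OF _ assms(4) der cont]) simp_all
qed

lemma LINT_unit_measure_eq:
  assumes "integrable unit_measure f"
  shows "(LINT x|unit_measure. f x) = integral {0..1} (f :: real \<Rightarrow> complex)"
proof -
  have "(LINT x|unit_measure. f x) = integral {0<..<1} f"
    by (rule lebesgue_integral_eq_integral[OF assms]) simp
  also have "\<dots> = integral {0..1} f"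
    by (rule integral_open_interval_real[symmetric])
  finally show ?thesis .
qed

lemma test_fun_C1_with_deriv:
  assumes "test_fun \<phi>"
  shows "C1_with_deriv \<phi> (fun_deriv \<phi>)" "\<phi> 0 = 0" "\<phi> 1 = 0"
proof -
  show "C1_with_deriv \<phi> (fun_deriv \<phi>)"
    using assms unfolding C1_with_deriv_def test_fun_def C1_differentiable_on_eq vector_derivative_works[symmetric]
    by auto
  have "{x. \<phi> x \<noteq> 0} \<subseteq> {0<..<1}"
    by (rule order.trans[OF closure_subset]) (use assms in \<open>simp add: test_fun_def\<close>)
  then show "\<phi> 0 = 0" "\<phi> 1 = 0" by auto
qed

text \<open>
  Integration by parts on each half; the boundary terms at \<open>1/2\<close> cancel because the pieces agree
  there, those at \<open>0\<close> and \<open>1\<close> because test functions vanish there.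
\<close>

lemma has_weak_deriv_glue:
  assumes "C1_with_deriv f1 g1" "C1_with_deriv f2 g2" "f1 (1/2) = f2 (1/2)"
  shows "has_weak_deriv (abs_l2 (glue f1 f2)) (abs_l2 (glue g1 g2))"
proof -
  have c: "continuous_on UNIV f1" "continuous_on UNIV f2" "continuous_on UNIV g1" "continuous_on UNIV g2"
    using assms C1_with_deriv_continuous unfolding C1_with_deriv_def by auto
  have sq: "square_integrable (glue f1 f2)" "square_integrable (glue g1 g2)"
    by (intro square_integrable_glue c)+
  have "(LINT x|unit_measure. glue f1 f2 x * fun_deriv \<phi> x) = - (LINT x|unit_measure. glue g1 g2 x * \<phi> x)"
    if t: "test_fun \<phi>" for \<phi>
  proof -
    note p = test_fun_C1_with_deriv[OF t] 
    have i: "integrable unit_measure (\<lambda>x. glue f1 f2 x * fun_deriv \<phi> x)"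
      "integrable unit_measure (\<lambda>x. glue g1 g2 x * \<phi> x)"
      using sq test_fun_square_integrable[OF t] by (auto intro: square_integrable_mult)
    let ?h = "\<lambda>x. glue f1 f2 x * fun_deriv \<phi> x + glue g1 g2 x * \<phi> x"
    have "(glue (\<lambda>x. f1 x * fun_deriv \<phi> x + g1 x * \<phi> x) (\<lambda>x. f2 x * fun_deriv \<phi> x + g2 x * \<phi> x)
      has_integral 0) {0..1}"
      using glue_has_integral[OF C1_with_deriv_mult[OF assms(1) p(1)] C1_with_deriv_mult[OF assms(2) p(1)], of 0 1]
        assms(3) p(2,3) by (simp add: glue_def)
    moreover have "?h = glue (\<lambda>x. f1 x * fun_deriv \<phi> x + g1 x * \<phi> x) (\<lambda>x. f2 x * fun_deriv \<phi> x + g2 x * \<phi> x)"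
      by (auto simp: glue_def)
    ultimately have "integral {0..1} ?h = 0" by (simp add: integral_unique)
    then have "(LINT x|unit_measure. ?h x) = 0"
      using LINT_unit_measure_eq[OF Bochner_Integration.integrable_add[OF i]] by simp
    then show ?thesis
      using Bochner_Integration.integral_add[OF i] by (simp add: add_eq_0_iff2)
  qed
  then show ?thesis using sq by (simp add: abs_l2_simps)
qed

section \<open>Approximation of glued functions by test functions\<close>

text \<open>
  Restricting entire functions to the line gives the pieces of the quasimodes; their derivatives
  are then computed by the rules for complex derivatives.
\<close>

lemma C1_with_deriv_of_real:
  assumes "\<And>z. (F has_field_derivative G z) (at z)" "continuous_on UNIV G"
  shows "C1_with_deriv (\<lambda>x. F (complex_of_real x)) (\<lambda>x. G (complex_of_real x))"
  unfolding C1_with_deriv_def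
  using assms(1) continuous_on_compose2[OF assms(2), of UNIV complex_of_real]
  by (auto intro!: has_vector_derivative_real_field continuous_intros)

text \<open>
  The mean of \<open>h\<close> has to vanish for its antiderivative to return to \<open>0\<close> beyond the support of \<open>h\<close>.
\<close>

lemma test_fun_antiderivative:
  assumes h: "continuous_on UNIV h" and z: "\<And>x. h x \<noteq> 0 \<Longrightarrow> a \<le> x \<and> x \<le> b"
    and ab: "0 < a" "a \<le> b" "b < 1" and int: "integral {0..1} h = (0::complex)"
  obtains \<phi> where "test_fun \<phi>" "fun_deriv \<phi> = h" 
    "\<And>x. 0 \<le> x \<Longrightarrow> x \<le> 1 \<Longrightarrow> \<phi> x = integral {0..x} h"
proof -
  have "\<exists>F. \<forall>x. (F has_vector_derivative h x) (at x)"
    using einterval_antiderivative[of "-\<infinity>" "\<infinity>" h] h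
    by (auto simp: continuous_on_eq_continuous_at)
  then obtain F where F: "\<And>x. (F has_vector_derivative h x) (at x)" by blast
  have ftc: "(h has_integral F x - F 0) {0..x}" if "0 \<le> x" for x
    using that F by (intro fundamental_theorem_of_calculus) (auto intro: has_vector_derivative_at_within)
  define \<phi> where "\<phi> x = F x - F 0" for x
  have d: "(\<phi> has_vector_derivative h x) (at x)" for x
    unfolding \<phi>_def using has_vector_derivative_diff[OF F[of x] has_vector_derivative_const[of "F 0"]] by simp
  have \<phi>: "\<phi> x = integral {0..x} h" if "0 \<le> x" for x
    using ftc[OF that] by (simp add: \<phi>_def integral_unique)
  have const: "\<exists>k. \<forall>x\<in>S. \<phi> x = k" if "convex S" "\<And>x. x \<in> S \<Longrightarrow> h x = 0" for S
    using has_vector_derivative_zero_constant[of S \<phi>] that d has_vector_derivative_at_within by metis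
  have "\<phi> x = 0" if "x < a" for x
  proof -
    obtain k where k: "\<forall>x\<in>{..<a}. \<phi> x = k" using const[of "{..<a}"] z by fastforce
    then have "\<phi> x = \<phi> 0" using that ab by simp
    then show ?thesis by (simp add: \<phi>_def)
  qed
  moreover have "\<phi> x = 0" if "b < x" for x
  proof -
    obtain k where k: "\<forall>x\<in>{b<..}. \<phi> x = k" using const[of "{b<..}"] z by fastforce
    then have "\<phi> x = \<phi> 1" using that ab by simp
    then show ?thesis using \<phi>[of 1] int by simp
  qed
  ultimately have supp: "a \<le> x \<and> x \<le> b" if "\<phi> x \<noteq> 0" for x
    using that by (meson not_le)
  show ?thesis
  proof (rule that)
    show "test_fun \<phi>" "fun_deriv \<phi> = h"
      by (rule test_funI[OF d h supp ab(1) ab(3)], assumption)+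
  qed (rule \<phi>)
qed

lemma bounded_convergence_l2:
  assumes meas: "\<And>n. k n \<in> borel_measurable unit_measure"
    and bnd: "\<And>n x. 0 < x \<Longrightarrow> x < 1 \<Longrightarrow> cmod (k n x) \<le> B"
    and lim: "\<And>x. 0 < x \<Longrightarrow> x < 1 \<Longrightarrow> x \<noteq> 1/2 \<Longrightarrow> (\<lambda>n. k n x) \<longlonglongrightarrow> 0"
  shows "(\<lambda>n. LINT x|unit_measure. cmod (k n x)) \<longlonglongrightarrow> 0"
    and "(\<lambda>n. norm (abs_l2 (k n))) \<longlonglongrightarrow> 0"
proof -
  interpret finite_measure unit_measure by (rule finite_measure_unit)
  have sq: "square_integrable (k n)" for n
    by (rule square_integrable_bounded[OF meas bnd])
  have ae: "AE x in unit_measure. (\<lambda>n. k n x) \<longlonglongrightarrow> 0"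
  proof -
    have "AE x in lebesgue. x \<notin> {1/2::real}"
      by (rule AE_not_in) (simp add: negligible_iff_null_sets[symmetric])
    then show ?thesis
      using lim by (auto simp: AE_restrict_space_iff elim!: eventually_mono)
  qed
  have "(\<lambda>n. LINT x|unit_measure. cmod (k n x)) \<longlonglongrightarrow> (LINT x|unit_measure. 0)"
  proof (rule integral_dominated_convergence[where w = "\<lambda>x. B"])
    show "AE x in unit_measure. (\<lambda>n. cmod (k n x)) \<longlonglongrightarrow> 0"
      using ae by eventually_elim (rule tendsto_norm_zero)
    show "AE x in unit_measure. norm (cmod (k n x)) \<le> B" for n
      using bnd by (intro AE_I2) auto
  qed (use meas in measurable)
  then show "(\<lambda>n. LINT x|unit_measure. cmod (k n x)) \<longlonglongrightarrow> 0" by simp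
  have "(\<lambda>n. LINT x|unit_measure. (cmod (k n x))\<^sup>2) \<longlonglongrightarrow> (LINT x|unit_measure. 0)"
  proof (rule integral_dominated_convergence[where w = "\<lambda>x. B\<^sup>2"])
    show "AE x in unit_measure. (\<lambda>n. (cmod (k n x))\<^sup>2) \<longlonglongrightarrow> 0"
      using ae 
    proof eventually_elim
      case (elim x)
      then have "(\<lambda>n. (cmod (k n x))\<^sup>2) \<longlonglongrightarrow> (cmod 0)\<^sup>2" by (intro tendsto_intros)
      then show ?case by simp
    qed
    show "AE x in unit_measure. norm ((cmod (k n x))\<^sup>2) \<le> B\<^sup>2" for n
      using bnd by (intro AE_I2) (auto intro: power_mono)
  qed (use meas in measurable)
  then have "(\<lambda>n. sqrt (LINT x|unit_measure. (cmod (k n x))\<^sup>2)) \<longlonglongrightarrow> sqrt 0"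
    by (intro tendsto_real_sqrt) simp
  then show "(\<lambda>n. norm (abs_l2 (k n))) \<longlonglongrightarrow> 0"
    by (simp add: abs_l2_simps sq)
qed

lemma norm_integral_le_L1:
  assumes d: "integrable unit_measure d" and x: "x \<le> 1"
  shows "cmod (integral {0..x} d) \<le> (LINT t|unit_measure. cmod (d t))"
proof -
  have i: "integrable unit_measure (\<lambda>t. indicator {0..x} t *\<^sub>R d t)"
  proof (rule Bochner_Integration.integrable_bound[OF d])
    show "(\<lambda>t. indicator {0..x} t *\<^sub>R d t) \<in> borel_measurable unit_measure"
      by (intro borel_measurable_scaleR sets_unit_indicator borel_measurable_integrable d) simp
  qed (simp add: indicator_def)
  have "{0..x} \<inter> {0..1} = {0..x}" using x by auto
  then have "integral {0..x} d = integral {0..1} (\<lambda>t. if t \<in> {0..x} then d t else 0)"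
    by (simp only: Henstock_Kurzweil_Integration.integral_restrict_Int)
  also have "\<dots> = integral {0..1} (\<lambda>t. indicator {0..x} t *\<^sub>R d t)"
    by (intro integral_cong) (simp add: indicator_def)
  also have "\<dots> = (LINT t|unit_measure. indicator {0..x} t *\<^sub>R d t)"
    by (rule LINT_unit_measure_eq[OF i, symmetric])
  also have "cmod \<dots> \<le> (LINT t|unit_measure. cmod (indicator {0..x} t *\<^sub>R d t))"
    by (rule integral_norm_bound)
  also have "\<dots> \<le> (LINT t|unit_measure. cmod (d t))"
    by (intro integral_mono integrable_norm i d) (simp add: indicator_def)
  finally show ?thesis .
qed

text \<open>
  A hat function. It is written through \<open>max 0\<close> so that its antiderivative, and hence its mass, is
  explicit.
\<close>

lemma unit_mass_bump:
  obtains \<psi> :: "real \<Rightarrow> complex" where "continuous_on UNIV \<psi>" "\<And>x. \<psi> x \<noteq> 0 \<Longrightarrow> 1/4 \<le> x \<and> x \<le> 3/4"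
    "integral {0..1} \<psi> = 1"
proof -
  \<comment> \<open>second differences of \<open>p\<close> and \<open>p'\<close> with step \<open>1/4\<close>; the factor \<open>8\<close> normalizes the mass\<close>
  define p where "p a x = complex_of_real ((max 0 (x - a))\<^sup>2)" for a x :: real
  define p' where "p' a x = complex_of_real (2 * max 0 (x - a))" for a x :: real
  have p: "(p a has_vector_derivative p' a x) (at x)" for a x
  proof -
    have "((\<lambda>x. x - a) has_real_derivative 1) (at x)"
      by (auto intro!: derivative_eq_intros)
    from DERIV_chain2[OF has_real_derivative_max_square this] show ?thesis
      unfolding p_def p'_def by (intro has_vector_derivative_of_real) simp
  qed
  have c: "continuous_on UNIV (p' a)" for a unfolding p'_def by (intro continuous_intros)
  define P where "P x = 8 * (p (1/4) x - 2 * p (1/2) x + p (3/4) x)" for x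
  define \<psi> where "\<psi> x = 8 * (p' (1/4) x - 2 * p' (1/2) x + p' (3/4) x)" for x
  show ?thesis
  proof (rule that[of \<psi>])
    show "continuous_on UNIV \<psi>" unfolding \<psi>_def by (intro continuous_intros c)
    show "1/4 \<le> x \<and> x \<le> 3/4" if "\<psi> x \<noteq> 0" for x
    proof (rule ccontr)
      assume "\<not> (1/4 \<le> x \<and> x \<le> 3/4)"
      then consider "x < 1/4" | "x > 3/4" by linarith
      then have "\<psi> x = 0"
        by cases (simp_all add: \<psi>_def p'_def max_def)
      then show False using that by simp
    qed
    have "(P has_vector_derivative \<psi> x) (at x)" for x
      unfolding P_def \<psi>_def
      by (intro has_vector_derivative_mult_right has_vector_derivative_add has_vector_derivative_diff p)
    then have "(P has_vector_derivative \<psi> x) (at x within {0..1})" for x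
      by (rule has_vector_derivative_at_within)
    then have "(\<psi> has_integral P 1 - P 0) {0..1}"
      by (intro fundamental_theorem_of_calculus) auto
    moreover have "P 1 - P 0 = 1"
      by (simp add: P_def p_def max_def power2_eq_square)
    ultimately show "integral {0..1} \<psi> = 1" by (simp add: integral_unique)
  qed
qed

text \<open>
  The cutoffs vanish near both ends of the interval, where test functions must vanish, and also near
  \<open>1/2\<close>, where the derivative of a glued function may jump: multiplied by a cutoff it becomes
  continuous.
\<close>

lemma cutoff_sequence:
  obtains \<rho> :: "nat \<Rightarrow> real \<Rightarrow> real" where
    "\<And>n. continuous_on UNIV (\<rho> n)" "\<And>n x. 0 \<le> \<rho> n x \<and> \<rho> n x \<le> 1" "\<And>n. \<rho> n (1/2) = 0"
    "\<And>n x. \<rho> n x \<noteq> 0 \<Longrightarrow> 1 / (real n + 5) \<le> x \<and> x \<le> 1 - 1 / (real n + 5)"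
    "\<And>x. 0 < x \<Longrightarrow> x < 1 \<Longrightarrow> x \<noteq> 1/2 \<Longrightarrow> (\<lambda>n. \<rho> n x) \<longlonglongrightarrow> 1"
proof -
  \<comment> \<open>on \<open>(0,1)\<close>, the distance to the nearest of the points \<open>0\<close>, \<open>1/2\<close> and \<open>1\<close>\<close>
  define m where "m x = min \<bar>x - 1/2\<bar> (1/2 - \<bar>x - 1/2\<bar>)" for x :: real
  define r where "r n x = max 0 (m x - 1 / (real n + 5))" for n x
  define \<rho> where "\<rho> n x = real n * r n x / (1 + real n * r n x)" for n x
  have r0: "0 \<le> r n x" for n x by (simp add: r_def)
  have pos: "1 + real n * r n x > 0" for n x using r0[of n x] by (simp add: add_pos_nonneg)
  show ?thesis
  proof (rule that[of \<rho>])
    show "continuous_on UNIV (\<rho> n)" for n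
      unfolding \<rho>_def r_def m_def
      by (intro continuous_intros) (use pos in \<open>auto simp: r_def m_def less_imp_neq[symmetric]\<close>)
    show "0 \<le> \<rho> n x \<and> \<rho> n x \<le> 1" for n x
      using r0[of n x] pos[of n x] by (simp add: \<rho>_def field_simps)
    have "0 < 1 / (real n + 5)" for n by simp
    then show "\<rho> n (1/2) = 0" for n by (simp add: \<rho>_def r_def m_def)
    show "1 / (real n + 5) \<le> x \<and> x \<le> 1 - 1 / (real n + 5)" if "\<rho> n x \<noteq> 0" for n x
    proof -
      have "r n x \<noteq> 0" using that by (auto simp: \<rho>_def)
      then have "m x > 1 / (real n + 5)" by (auto simp: r_def max_def split: if_splits)
      then show ?thesis unfolding m_def by linarith
    qed
    show "(\<lambda>n. \<rho> n x) \<longlonglongrightarrow> 1" if "0 < x" "x < 1" "x \<noteq> 1/2" for x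
    proof -
      have "m x > 0" using that unfolding m_def by linarith
      have "(\<lambda>n. 1 / (real n + 5)) \<longlonglongrightarrow> 0" by real_asymp
      then have "(\<lambda>n. r n x) \<longlonglongrightarrow> max 0 (m x - 0)"
        unfolding r_def by (intro tendsto_intros)
      then have "filterlim (\<lambda>n. r n x * real n) at_top sequentially"
        using \<open>m x > 0\<close> by (intro filterlim_tendsto_pos_mult_at_top filterlim_real_sequentially) auto
      moreover have "((\<lambda>y::real. y / (1 + y)) \<longlongrightarrow> 1) at_top" by real_asymp
      ultimately have "(\<lambda>n. r n x * real n / (1 + r n x * real n)) \<longlonglongrightarrow> 1"
        by (rule filterlim_compose[rotated])
      then show ?thesis by (simp add: \<rho>_def mult.commute)
    qed
  qed
qed

text \<open>
  The approximation is made at the level of derivatives. Cutting off the derivative \<open>g\<close> makes it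
  continuous with compact support but spoils its mean, which is \<open>0\<close> by the boundary conditions.
  Subtracting a small multiple of a fixed bump restores the mean, so that the antiderivatives are
  test functions. Bounded convergence of the derivatives yields convergence of the functions.
\<close>

lemma glue_in_H1_0:
  assumes f1: "C1_with_deriv f1 g1" and f2: "C1_with_deriv f2 g2" and eq: "f1 (1/2) = f2 (1/2)"
    and bd: "f1 0 = 0" "f2 1 = 0"
  shows "abs_l2 (glue f1 f2) \<in> H1_0"
proof -
  let ?f = "glue f1 f2" and ?g = "glue g1 g2"
  have c: "continuous_on UNIV f1" "continuous_on UNIV f2" "continuous_on UNIV g1" "continuous_on UNIV g2"
    using f1 f2 C1_with_deriv_continuous unfolding C1_with_deriv_def by auto
  have sq: "square_integrable ?f" "square_integrable ?g"
    by (intro square_integrable_glue c)+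
  have wd: "has_weak_deriv (abs_l2 ?f) (abs_l2 ?g)"
    by (rule has_weak_deriv_glue[OF f1 f2 eq])
  have gint: "(?g has_integral ?f x) {0..x}" if "0 \<le> x" for x
    using glue_has_integral[OF f1 f2 eq that] bd by (simp add: glue_def)
  obtain B where B: "B > 0" "\<And>x. 0 \<le> x \<Longrightarrow> x \<le> 1 \<Longrightarrow> cmod (?g x) \<le> B"
    using glue_bounded[OF c(3,4)] by blast
  obtain \<psi> :: "real \<Rightarrow> complex" where \<psi>: "continuous_on UNIV \<psi>" 
      "\<And>x. \<psi> x \<noteq> 0 \<Longrightarrow> 1/4 \<le> x \<and> x \<le> 3/4" "integral {0..1} \<psi> = 1"
    using unit_mass_bump by blast
  obtain C where C: "C > 0" "\<And>x. 0 \<le> x \<Longrightarrow> x \<le> 1 \<Longrightarrow> cmod (\<psi> x) \<le> C"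
    using glue_bounded[OF \<psi>(1) \<psi>(1)] by (auto simp: glue_def)
  obtain \<rho> :: "nat \<Rightarrow> real \<Rightarrow> real" where \<rho>: "\<And>n. continuous_on UNIV (\<rho> n)" 
      "\<And>n x. 0 \<le> \<rho> n x \<and> \<rho> n x \<le> 1" "\<And>n. \<rho> n (1/2) = 0"
      "\<And>n x. \<rho> n x \<noteq> 0 \<Longrightarrow> 1 / (real n + 5) \<le> x \<and> x \<le> 1 - 1 / (real n + 5)"
      "\<And>x. 0 < x \<Longrightarrow> x < 1 \<Longrightarrow> x \<noteq> 1/2 \<Longrightarrow> (\<lambda>n. \<rho> n x) \<longlonglongrightarrow> 1"
    using cutoff_sequence by blast
  \<comment> \<open>the cut-off derivative; \<open>m n\<close> below is its mean and \<open>h n\<close> its mean-free correction\<close>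
  define k where "k n x = complex_of_real (\<rho> n x) * ?g x" for n x
  have kc: "continuous_on A (k n)" for n A
  proof -
    have "k n = glue (\<lambda>x. complex_of_real (\<rho> n x) * g1 x) (\<lambda>x. complex_of_real (\<rho> n x) * g2 x)"
      by (simp add: k_def glue_def fun_eq_iff)
    then show ?thesis
      using \<rho>(3) by (auto intro!: continuous_on_glue continuous_intros \<rho>(1) c)
  qed
  have kdiff: "cmod (k n x - ?g x) \<le> B" if "0 < x" "x < 1" for n x
  proof -
    have "k n x - ?g x = complex_of_real (\<rho> n x - 1) * ?g x"
      by (simp add: k_def left_diff_distrib)
    then have "cmod (k n x - ?g x) = \<bar>\<rho> n x - 1\<bar> * cmod (?g x)"
      by (simp only: norm_mult norm_of_real)
    also have "\<dots> \<le> 1 * B"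
      using \<rho>(2)[of n x] B that by (intro mult_mono) (auto simp: abs_le_iff)
    finally show ?thesis by simp
  qed
  have gm: "?g \<in> borel_measurable unit_measure"
    by (rule glue_measurable[OF c(3,4)])
  have cm: "f \<in> borel_measurable unit_measure" if "continuous_on UNIV f" for f :: "real \<Rightarrow> complex"
    using glue_measurable[OF that that] by (simp add: glue_def)
  have kdm: "(\<lambda>x. k n x - ?g x) \<in> borel_measurable unit_measure" for n
    by (intro borel_measurable_diff cm kc gm)
  define m where "m n = integral {0..1} (k n)" for n
  have m_le: "cmod (m n) \<le> (LINT x|unit_measure. cmod (k n x - ?g x))" for n
  proof -
    have sqd: "square_integrable (\<lambda>x. k n x - ?g x)"
      by (rule square_integrable_bounded[OF kdm kdiff])
    have "?g integrable_on {0..1}" "integral {0..1} ?g = 0"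
      using gint[of 1] bd by (auto simp: glue_def integral_unique)
    moreover have "k n integrable_on {0..1}"
      by (intro integrable_continuous_interval kc)
    ultimately have "m n = integral {0..1} (\<lambda>x. k n x - ?g x)"
      by (simp add: m_def integral_diff)
    also have "\<dots> = (LINT x|unit_measure. k n x - ?g x)"
      using LINT_unit_measure_eq[OF square_integrable_imp_integrable[OF sqd]] by simp
    finally show ?thesis by simp
  qed
  have klim: "(\<lambda>n. k n x - ?g x) \<longlonglongrightarrow> 0" if "0 < x" "x < 1" "x \<noteq> 1/2" for x
  proof -
    have "(\<lambda>n. k n x - ?g x) \<longlonglongrightarrow> complex_of_real 1 * ?g x - ?g x"
      unfolding k_def by (intro tendsto_intros \<rho>(5) that)
    then show ?thesis by simp
  qed
  have "(\<lambda>n. LINT x|unit_measure. cmod (k n x - ?g x)) \<longlonglongrightarrow> 0"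
    by (rule bounded_convergence_l2(1)[OF kdm kdiff klim])
  then have mlim: "m \<longlonglongrightarrow> 0"
    by (rule Lim_null_comparison[OF always_eventually, rotated]) (use m_le in auto)
  obtain E where E: "\<And>n. cmod (m n) \<le> E"
    using convergent_imp_Bseq[of m] mlim by (auto simp: convergent_def Bseq_def)
  define h where "h n x = k n x - m n * \<psi> x" for n x
  have hc: "continuous_on A (h n)" for n A
    unfolding h_def using continuous_on_subset[OF \<psi>(1)] by (intro continuous_intros kc) auto
  have hint: "integral {0..1} (h n) = 0" for n
  proof -
    have "k n integrable_on {0..1}" "(\<lambda>x. m n * \<psi> x) integrable_on {0..1}"
      using continuous_on_subset[OF \<psi>(1)]
      by (auto intro!: integrable_continuous_interval kc continuous_intros)
    from integral_diff[OF this] show ?thesis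
      by (simp add: h_def[abs_def] m_def[symmetric] \<psi>(3))
  qed
  have hsupp: "1 / (real n + 5) \<le> x \<and> x \<le> 1 - 1 / (real n + 5)" if "h n x \<noteq> 0" for n x
  proof (cases "\<rho> n x = 0")
    case True
    then have "1/4 \<le> x \<and> x \<le> 3/4" using that \<psi>(2)[of x] by (auto simp: h_def k_def)
    moreover have "1 / (real n + 5) \<le> 1/4" by (simp add: field_simps)
    ultimately show ?thesis by linarith
  qed (use \<rho>(4) in blast)
  have "\<exists>\<phi>. test_fun \<phi> \<and> fun_deriv \<phi> = h n \<and> (\<forall>x. 0 \<le> x \<longrightarrow> x \<le> 1 \<longrightarrow> \<phi> x = integral {0..x} (h n))" for n
  proof -
    have "1 / (real n + 5) \<le> 1/4" "0 < 1 / (real n + 5)" by (simp_all add: field_simps)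
    then have "0 < 1 / (real n + 5)" "1 / (real n + 5) \<le> 1 - 1 / (real n + 5)" "1 - 1 / (real n + 5) < 1"
      by linarith+
    then show ?thesis
      using test_fun_antiderivative[OF hc hsupp _ _ _ hint] by metis
  qed
  then obtain \<phi> where \<phi>: "\<And>n. test_fun (\<phi> n)" "\<And>n. fun_deriv (\<phi> n) = h n" 
      "\<And>n x. 0 \<le> x \<Longrightarrow> x \<le> 1 \<Longrightarrow> \<phi> n x = integral {0..x} (h n)"
    by metis
  have hdm: "(\<lambda>x. h n x - ?g x) \<in> borel_measurable unit_measure" for n
    by (intro borel_measurable_diff cm hc gm)
  have hdiff: "cmod (h n x - ?g x) \<le> B + E * C" if "0 < x" "x < 1" for n x
  proof -
    have "cmod (h n x - ?g x) = cmod ((k n x - ?g x) - m n * \<psi> x)"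
      by (simp add: h_def algebra_simps)
    also have "\<dots> \<le> cmod (k n x - ?g x) + cmod (m n) * cmod (\<psi> x)"
      by (metis norm_triangle_ineq4 norm_mult)
    also have "\<dots> \<le> B + E * C"
      using kdiff[OF that, of n] E[of n] C(2)[of x] that order_trans[OF norm_ge_zero E]
      by (intro add_mono mult_mono) auto
    finally show ?thesis .
  qed
  have hlim: "(\<lambda>n. h n x - ?g x) \<longlonglongrightarrow> 0" if "0 < x" "x < 1" "x \<noteq> 1/2" for x
  proof -
    have "(\<lambda>n. (k n x - ?g x) - m n * \<psi> x) \<longlonglongrightarrow> 0 - 0 * \<psi> x"
      by (intro tendsto_intros klim that mlim)
    then show ?thesis by (simp add: h_def algebra_simps)
  qed
  note hconv = bounded_convergence_l2[OF hdm hdiff hlim]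
  define e where "e n = (LINT x|unit_measure. cmod (h n x - ?g x))" for n
  have e_lim: "e \<longlonglongrightarrow> 0" unfolding e_def by (rule hconv(1))
  have \<phi>_diff: "cmod (\<phi> n x - ?f x) \<le> e n" if x: "0 < x" "x < 1" for n x
  proof -
    have sqd: "square_integrable (\<lambda>x. h n x - ?g x)"
      by (rule square_integrable_bounded[OF hdm hdiff])
    have hi: "h n integrable_on {0..x}" by (intro integrable_continuous_interval hc)
    have gi: "(?g has_integral ?f x) {0..x}" using gint[of x] x by simp
    have "\<phi> n x - ?f x = integral {0..x} (\<lambda>t. h n t - ?g t)"
      using \<phi>(3)[of x n] x hi gi by (simp add: integral_diff has_integral_integrable integral_unique)
    then show ?thesis
      using norm_integral_le_L1[OF square_integrable_imp_integrable[OF sqd], of x] x by (simp add: e_def)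
  qed
  have fm: "(\<lambda>x. \<phi> n x - ?f x) \<in> borel_measurable unit_measure" for n
    using test_fun_measurable(1)[OF \<phi>(1)] sq(1) by (auto simp: square_integrable_def)
  obtain E' where E': "\<And>n. \<bar>e n\<bar> \<le> E'"
    using convergent_imp_Bseq[of e] e_lim by (auto simp: convergent_def Bseq_def)
  have "(\<lambda>n. norm (abs_l2 (\<lambda>x. \<phi> n x - ?f x))) \<longlonglongrightarrow> 0"
  proof (rule bounded_convergence_l2(2)[OF fm])
    show "cmod (\<phi> n x - ?f x) \<le> E'" if "0 < x" "x < 1" for n x
      using \<phi>_diff[OF that, of n] E'[of n] by linarith
    show "(\<lambda>n. \<phi> n x - ?f x) \<longlonglongrightarrow> 0" if "0 < x" "x < 1" for x
      using \<phi>_diff[OF that] by (intro Lim_null_comparison[OF _ e_lim] always_eventually) auto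
  qed
  then have "(\<lambda>n. norm (abs_l2 (\<phi> n) - abs_l2 ?f)) \<longlonglongrightarrow> 0"
    using sq test_fun_square_integrable[OF \<phi>(1)] by (simp add: abs_l2_simps)
  moreover have "(\<lambda>n. norm (abs_l2 (h n) - abs_l2 ?g)) \<longlonglongrightarrow> 0"
    using hconv(2) sq test_fun_square_integrable(2)[OF \<phi>(1)] \<phi>(2) by (simp add: abs_l2_simps)
  ultimately have "(\<lambda>n. (abs_l2 (\<phi> n), abs_l2 (h n))) \<longlonglongrightarrow> (abs_l2 ?f, abs_l2 ?g)"
    by (intro tendsto_Pair) (simp_all add: tendsto_norm_zero_iff LIM_zero_iff)
  moreover have "(abs_l2 (\<phi> n), abs_l2 (h n)) \<in> test_graph" for n
    using \<phi> by (auto simp: test_graph_def intro!: image_eqI[of _ _ "\<phi> n"])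
  ultimately have "(abs_l2 ?f, abs_l2 ?g) \<in> closure test_graph"
    unfolding closure_sequential by (intro exI[of _ "\<lambda>n. (abs_l2 (\<phi> n), abs_l2 (h n))"]) auto
  then show ?thesis
    using H1I[OF wd] weak_derivI[OF wd] by (simp add: H1_0_iff)
qed

section \<open>The energy space\<close>

text \<open>
  On the energy space this is a linear map into \<open>l2 \<times> l2 \<times> l2 \<times> l2\<close> whose norm is the energy norm.
  It transfers the triangle inequality and homogeneity from the product space.
\<close>

fun energy_vector :: "state \<Rightarrow> state" where
  "energy_vector (u, v, y, z) = (v, weak_deriv u, z, weak_deriv y)"

lemma energy_norm_eq: "energy_norm U = norm (energy_vector U)"
  by (cases U) (simp add: norm_Pair add.assoc)

lemma zero_H1_0: "0 \<in> H1_0" "weak_deriv 0 = 0"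
proof -
  have z: "glue (\<lambda>x. 0) (\<lambda>x. 0) = (\<lambda>x. 0)" by (simp add: glue_def fun_eq_iff)
  have t: "test_fun (\<lambda>x. 0)" and d: "fun_deriv (\<lambda>x. 0) = (\<lambda>x. 0)"
    using test_funI[of "\<lambda>x. 0" "\<lambda>x. 0" "1/4" "3/4"] by auto
  have w: "has_weak_deriv 0 0"
    using has_weak_deriv_glue[of "\<lambda>x. 0" "\<lambda>x. 0" "\<lambda>x. 0" "\<lambda>x. 0"]
    unfolding z zero_l2_def by (simp add: C1_with_deriv_def)
  then show "weak_deriv 0 = 0" by (rule weak_derivI)
  have "(0, 0) \<in> test_graph"
    unfolding test_graph_def zero_l2_def using t d by (auto intro!: image_eqI[of _ _ "\<lambda>x. 0"])
  then show "0 \<in> H1_0"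
    using closure_subset H1I[OF w] by (auto simp: H1_0_iff weak_derivI[OF w])
qed

lemma scaleC_state_in_energy_space:
  assumes "U \<in> energy_space"
  shows "scaleC_state a U \<in> energy_space"
proof -
  have "scaleC_l2 a u \<in> H1_0" if "u \<in> H1_0" for u
    using H1_0_combination[OF that zero_H1_0(1), of a 0] norm_scaleC_l2[of 0 0] by simp
  then show ?thesis using assms by (cases U) (auto simp: energy_space_def)
qed

lemma add_in_energy_space:
  assumes "U \<in> energy_space" "V \<in> energy_space"
  shows "U + V \<in> energy_space"
proof -
  have "u + v \<in> H1_0" if "u \<in> H1_0" "v \<in> H1_0" for u v
    using H1_0_combination[OF that, of 1 1] by (simp add: scaleC_l2_one)
  then show ?thesis using assms by (cases U, cases V) (auto simp: energy_space_def)
qed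

lemma energy_vector_add:
  "U \<in> energy_space \<Longrightarrow> V \<in> energy_space \<Longrightarrow> energy_vector (U + V) = energy_vector U + energy_vector V"
  by (cases U, cases V) (auto simp: energy_space_def weak_deriv_add H1_0_imp_H1)

lemma energy_vector_scaleC:
  "U \<in> energy_space \<Longrightarrow> energy_vector (scaleC_state a U) = scaleC_state a (energy_vector U)"
  by (cases U) (auto simp: energy_space_def weak_deriv_scaleC H1_0_imp_H1)

lemma scaleC_state_of_real: "scaleC_state (complex_of_real r) U = r *\<^sub>R U"
  by (cases U) (simp add: scaleR_l2_eq)

lemma scaleC_state_scaleC: "scaleC_state a (scaleC_state b U) = scaleC_state (a * b) U"
  by (cases U) (simp add: scaleC_l2_scaleC)

lemma scaleC_state_add: "scaleC_state a (U + V) = scaleC_state a U + scaleC_state a V"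
  by (cases U, cases V) (simp add: scaleC_l2_add)

lemma scaleC_state_add_left: "scaleC_state (a + b) U = scaleC_state a U + scaleC_state b U"
  by (cases U) (simp add: scaleC_l2_add_left)

lemma norm_scaleC_state: "norm (scaleC_state a U) = cmod a * norm U"
  by (cases U) (simp add: norm_Pair norm_scaleC_l2 power_mult_distrib distrib_left[symmetric] 
      real_sqrt_mult)

lemma energy_norm_add:
  "U \<in> energy_space \<Longrightarrow> V \<in> energy_space \<Longrightarrow> energy_norm (U + V) \<le> energy_norm U + energy_norm V"
  by (simp add: energy_norm_eq energy_vector_add norm_triangle_ineq)

lemma energy_norm_scaleC:
  "U \<in> energy_space \<Longrightarrow> energy_norm (scaleC_state a U) = cmod a * energy_norm U"
  by (simp add: energy_norm_eq energy_vector_scaleC norm_scaleC_state)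

lemma energy_norm_nonneg: "0 \<le> energy_norm U"
  by (simp add: energy_norm_eq)

lemma uminus_eq_scaleC_state: "- U = scaleC_state (- 1) U"
  using scaleC_state_of_real[of "-1" U] by simp

lemma diff_in_energy_space:
  "U \<in> energy_space \<Longrightarrow> V \<in> energy_space \<Longrightarrow> U - V \<in> energy_space"
  using add_in_energy_space[OF _ scaleC_state_in_energy_space[of V "-1"], of U]
  by (simp add: uminus_eq_scaleC_state[symmetric])

lemma scaleR_in_energy_space: "U \<in> energy_space \<Longrightarrow> r *\<^sub>R U \<in> energy_space"
  by (metis scaleC_state_of_real scaleC_state_in_energy_space)

lemma energy_norm_scaleR: "U \<in> energy_space \<Longrightarrow> energy_norm (r *\<^sub>R U) = \<bar>r\<bar> * energy_norm U"
  using energy_norm_scaleC[of U "complex_of_real r"] by (simp add: scaleC_state_of_real)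

section \<open>A resolvent bound from exponential stability\<close>

text \<open>
  Telescoping: each step of length \<open>h\<close> of the semigroup reproduces the earlier deviation up to a
  phase and adds the image, under a contraction, of one single-step deviation.
\<close>

lemma energy_norm_deviation_step:
  fixes w :: complex
  assumes T: "C0_contraction_semigroup T" and U: "U \<in> energy_space" and h: "0 \<le> h" and w: "w \<in> \<real>"
  defines "d \<equiv> \<lambda>t. energy_norm (T t U - scaleC_state (exp (\<i> * w * complex_of_real t)) U)"
  shows "d (real n * h) \<le> real n * d h"
proof (induction n)
  case 0
  have "T 0 U = U" using T U by (simp add: C0_contraction_semigroup_def)
  moreover have "scaleC_state 1 U = U" using scaleC_state_of_real[of 1 U] by simp
  ultimately show ?case
    using energy_norm_scaleR[OF U, of 0] by (simp add: d_def)
next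
  case (Suc n)
  define s where "s = real n * h"
  have s: "0 \<le> s" using h by (simp add: s_def)
  have T_in: "\<And>t U. 0 \<le> t \<Longrightarrow> U \<in> energy_space \<Longrightarrow> T t U \<in> energy_space"
    and T_add: "\<And>t U V. 0 \<le> t \<Longrightarrow> U \<in> energy_space \<Longrightarrow> V \<in> energy_space \<Longrightarrow> T t (U + V) = T t U + T t V"
    and T_scale: "\<And>t a U. 0 \<le> t \<Longrightarrow> U \<in> energy_space \<Longrightarrow> T t (scaleC_state a U) = scaleC_state a (T t U)"
    and T_contr: "\<And>t U. 0 \<le> t \<Longrightarrow> U \<in> energy_space \<Longrightarrow> energy_norm (T t U) \<le> energy_norm U"
    and T_semi: "\<And>s t U. 0 \<le> s \<Longrightarrow> 0 \<le> t \<Longrightarrow> U \<in> energy_space \<Longrightarrow> T (s + t) U = T s (T t U)"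
    using T unfolding C0_contraction_semigroup_def by blast+
  let ?e = "\<lambda>t. exp (\<i> * w * complex_of_real t)"
  note mem = T_in[OF s U] T_in[OF h U] scaleC_state_in_energy_space[OF U] diff_in_energy_space
    T_in[OF s] scaleC_state_in_energy_space
  define V where "V = T h U - scaleC_state (?e h) U"
  define W where "W = T s U - scaleC_state (?e s) U"
  have V: "V \<in> energy_space" and W: "W \<in> energy_space"
    unfolding V_def W_def by (intro mem)+
  have "T h U = V + scaleC_state (?e h) U" by (simp add: V_def)
  then have "T (s + h) U = T s V + scaleC_state (?e h) (T s U)"
    by (simp add: T_semi s h U T_add V mem T_scale)
  also have "T s U = W + scaleC_state (?e s) U" by (simp add: W_def)
  also have "scaleC_state (?e h) \<dots> = scaleC_state (?e h) W + scaleC_state (?e (s + h)) U"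
    by (simp add: scaleC_state_add scaleC_state_scaleC exp_add[symmetric] algebra_simps)
  finally have "T (s + h) U - scaleC_state (?e (s + h)) U = T s V + scaleC_state (?e h) W"
    by simp
  then have "d (s + h) \<le> energy_norm (T s V) + energy_norm (scaleC_state (?e h) W)"
    unfolding d_def using energy_norm_add[of "T s V" "scaleC_state (?e h) W"] mem V W by simp
  also have "energy_norm (T s V) \<le> d h"
    using T_contr[OF s V] by (simp add: V_def d_def)
  also have "energy_norm (scaleC_state (?e h) W) = d s"
  proof -
    have "cmod (?e h) = 1"
      using w by (auto simp: Reals_def)
    then show ?thesis by (simp add: energy_norm_scaleC[OF W]) (simp add: W_def d_def)
  qed
  finally have "d (s + h) \<le> d h + d s" by simp
  moreover have "s + h = real (Suc n) * h" by (simp add: s_def algebra_simps)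
  ultimately show ?case using Suc by (simp add: s_def algebra_simps)
qed

text \<open>
  The inequality that variation of constants gives for \<open>d/dt (e\<^sup>-\<^sup>i\<^sup>w\<^sup>t T(t) U)\<close>, obtained without
  integrals of vector-valued functions: for small \<open>h\<close> the deviation is at most \<open>h\<close> times the norm of
  the residual plus \<open>o(h)\<close>, and \<open>t\<close> is divided into many steps.
\<close>

lemma energy_norm_deviation_le:
  assumes T: "C0_contraction_semigroup T" and gen: "has_generator_value T U F"
    and t: "0 < t" and w: "w \<in> \<real>"
  shows "energy_norm (T t U - scaleC_state (exp (\<i> * w * t)) U)
     \<le> t * energy_norm (scaleC_state (\<i> * w) U - F)"
proof -
  have U: "U \<in> energy_space" and F: "F \<in> energy_space"
    and lim: "((\<lambda>h. energy_norm ((1 / h) *\<^sub>R (T h U - U) - F)) \<longlongrightarrow> 0) (at_right 0)"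
    using gen by (auto simp: has_generator_value_def)
  have T_in: "\<And>t. 0 \<le> t \<Longrightarrow> T t U \<in> energy_space"
    using T U by (simp add: C0_contraction_semigroup_def)
  define d where "d s = energy_norm (T s U - scaleC_state (exp (\<i> * w * complex_of_real s)) U)" for s
  define G where "G = scaleC_state (\<i> * w) U - F"
  have G: "G \<in> energy_space"
    unfolding G_def by (intro diff_in_energy_space scaleC_state_in_energy_space U F)
  \<comment> \<open>\<open>h * p h\<close> bounds the deviation after one step; \<open>q\<close> is the error of the difference quotient of
    the phase\<close>
  define q where "q h = (exp (\<i> * w * complex_of_real h) - 1) / complex_of_real h - \<i> * w" for h
  define p where "p h = energy_norm ((1 / h) *\<^sub>R (T h U - U) - F) + energy_norm G + cmod (q h) * energy_norm U" for h
  have q_lim: "((\<lambda>h. cmod (q h)) \<longlongrightarrow> 0) (at_right 0)"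
  proof -
    have "((\<lambda>s. exp (\<i> * w * s)) has_field_derivative exp (\<i> * w * 0) * (\<i> * w)) (at 0)"
      by (auto intro!: derivative_eq_intros)
    then have "((\<lambda>x. exp (\<i> * w * complex_of_real x)) has_vector_derivative \<i> * w) (at 0)"
      using has_vector_derivative_real_field[of "\<lambda>s. exp (\<i> * w * s)" "\<i> * w" 0] by simp
    then have "((\<lambda>h. (exp (\<i> * w * complex_of_real h) - 1 - h *\<^sub>R (\<i> * w)) /\<^sub>R \<bar>h\<bar>) \<longlongrightarrow> 0) (at 0)"
      by (simp add: has_vector_derivative_def has_derivative_def)
    then have "((\<lambda>h. cmod ((exp (\<i> * w * complex_of_real h) - 1 - h *\<^sub>R (\<i> * w)) /\<^sub>R \<bar>h\<bar>)) \<longlongrightarrow> 0) (at_right 0)"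
      by (intro tendsto_norm_zero) (rule tendsto_mono[OF at_le], auto)
    then show ?thesis
    proof (rule Lim_transform_eventually)
      show "\<forall>\<^sub>F h in at_right 0. cmod ((exp (\<i> * w * complex_of_real h) - 1 - h *\<^sub>R (\<i> * w)) /\<^sub>R \<bar>h\<bar>) = cmod (q h)"
        using eventually_at_right_less[of 0]
      proof eventually_elim
        case (elim h)
        have "(exp (\<i> * w * complex_of_real h) - 1 - h *\<^sub>R (\<i> * w)) /\<^sub>R \<bar>h\<bar> = q h"
          using elim by (simp add: q_def scaleR_conv_of_real field_simps)
        then show ?case by simp
      qed
    qed
  qed
  have p_lim: "(p \<longlongrightarrow> energy_norm G) (at_right 0)"
  proof -
    have "(p \<longlongrightarrow> 0 + energy_norm G + 0 * energy_norm U) (at_right 0)"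
      unfolding p_def by (intro tendsto_add tendsto_mult tendsto_const lim q_lim)
    then show ?thesis by simp
  qed
  have step: "d h \<le> h * p h" if h: "0 < h" for h
  proof -
    have eh: "exp (\<i> * w * complex_of_real h) = 1 + complex_of_real h * (\<i> * w) + complex_of_real h * q h"
      using h by (simp add: q_def field_simps)
    define D where "D = (1 / h) *\<^sub>R (T h U - U) - F"
    have D: "D \<in> energy_space"
      unfolding D_def using h by (intro diff_in_energy_space scaleR_in_energy_space T_in U F) simp
    have "T h U - U = h *\<^sub>R (D + F)"
      using h by (simp add: D_def)
    moreover have "scaleC_state (exp (\<i> * w * complex_of_real h)) U = 
        U + h *\<^sub>R scaleC_state (\<i> * w) U + h *\<^sub>R scaleC_state (q h) U"
    proof -
      have one: "scaleC_state 1 U = U" using scaleC_state_of_real[of 1 U] by simp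
      show ?thesis
        by (simp only: eh scaleC_state_add_left one scaleC_state_scaleC[symmetric] scaleC_state_of_real)
    qed
    ultimately have "T h U - scaleC_state (exp (\<i> * w * complex_of_real h)) U 
        = h *\<^sub>R (D - G - scaleC_state (q h) U)"
      by (simp add: G_def algebra_simps)
    then have "d h = h * energy_norm (D - G - scaleC_state (q h) U)"
      using h D G U
      by (simp add: d_def energy_norm_scaleR diff_in_energy_space scaleC_state_in_energy_space)
    also have "energy_norm (D - G - scaleC_state (q h) U) \<le> p h"
    proof -
      have "energy_norm (X - Y) \<le> energy_norm X + energy_norm Y" 
        if "X \<in> energy_space" "Y \<in> energy_space" for X Y
        using energy_norm_add[OF that(1) scaleC_state_in_energy_space[OF that(2), of "-1"]]
          energy_norm_scaleC[OF that(2), of "-1"]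
        by (simp add: uminus_eq_scaleC_state[symmetric])
      from this[of "D - G" "scaleC_state (q h) U"] this[of D G] show ?thesis
        using D G U by (simp add: p_def D_def[symmetric] energy_norm_scaleC diff_in_energy_space 
            scaleC_state_in_energy_space)
    qed
    finally show ?thesis using h by simp
  qed
  have "d t \<le> t * p (t / real (Suc n))" for n
  proof -
    have h: "0 < t / real (Suc n)" using t by simp
    have "d t = d (real (Suc n) * (t / real (Suc n)))" by simp
    also have "\<dots> \<le> real (Suc n) * d (t / real (Suc n))"
      unfolding d_def using energy_norm_deviation_step[OF T U _ w, of "t / real (Suc n)" "Suc n"] h by simp
    also have "\<dots> \<le> real (Suc n) * (t / real (Suc n) * p (t / real (Suc n)))"
      using step[OF h] by (intro mult_left_mono) auto
    finally show ?thesis by simp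
  qed
  moreover have "(\<lambda>n. t * p (t / real (Suc n))) \<longlonglongrightarrow> t * energy_norm G"
  proof -
    have "filterlim (\<lambda>n. t / real (Suc n)) (at_right 0) sequentially"
      using t by real_asymp
    then show ?thesis
      by (intro tendsto_intros filterlim_compose[OF p_lim])
  qed
  ultimately have "d t \<le> t * energy_norm G"
    by (intro LIMSEQ_le_const) auto
  then show ?thesis by (simp add: d_def G_def)
qed

text \<open>
  Up to the time \<open>t\<close> at which the semigroup has lost half of the norm of every state, a state with
  small residual has only changed its phase; hence its norm is at most \<open>2 t\<close> times its residual.
\<close>

lemma exponentially_stable_imp_resolvent_bound:
  assumes T: "C0_contraction_semigroup T" and "exponentially_stable T"
  obtains K where "K > 0" "\<And>U F w. has_generator_value T U F \<Longrightarrow>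
    energy_norm U \<le> K * energy_norm (scaleC_state (\<i> * complex_of_real w) U - F)"
proof -
  obtain M \<epsilon> where M: "M > 0" "\<epsilon> > 0"
    and stab: "\<And>t U. t > 0 \<Longrightarrow> U \<in> energy_space \<Longrightarrow> energy_norm (T t U) \<le> M * exp (- \<epsilon> * t) * energy_norm U"
    using assms(2) unfolding exponentially_stable_def by blast
  have "((\<lambda>t. M * exp (- \<epsilon> * t)) \<longlongrightarrow> 0) at_top"
    using M by real_asymp
  then have "\<forall>\<^sub>F t in at_top. M * exp (- \<epsilon> * t) < 1 / 2"
    by (rule order_tendstoD) simp
  then have "\<forall>\<^sub>F t in at_top. 0 < t \<and> M * exp (- \<epsilon> * t) < 1 / 2"
    using eventually_gt_at_top[of 0] by eventually_elim simp
  then obtain t where t: "0 < t" "M * exp (- \<epsilon> * t) < 1 / 2"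
    using eventually_happens trivial_limit_at_top_linorder by blast
  show ?thesis
  proof (rule that[of "2 * t"])
    fix U F w assume gen: "has_generator_value T U F"
    let ?G = "scaleC_state (\<i> * complex_of_real w) U - F" and ?e = "exp (\<i> * complex_of_real w * t)"
    have U: "U \<in> energy_space" using gen by (simp add: has_generator_value_def)
    have TU: "T t U \<in> energy_space"
      using T U t unfolding C0_contraction_semigroup_def by simp
    have dev: "energy_norm (T t U - scaleC_state ?e U) \<le> t * energy_norm ?G"
      by (rule energy_norm_deviation_le[OF T gen t(1)]) simp
    have "cmod ?e = 1" by simp
    then have "energy_norm U = energy_norm (scaleC_state ?e U)"
      by (simp add: energy_norm_scaleC[OF U])
    also have "\<dots> = energy_norm (T t U + scaleC_state (- 1) (T t U - scaleC_state ?e U))"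
      by (simp add: uminus_eq_scaleC_state[symmetric])
    also have "\<dots> \<le> energy_norm (T t U) + energy_norm (T t U - scaleC_state ?e U)"
      using energy_norm_add[OF TU scaleC_state_in_energy_space]
        diff_in_energy_space[OF TU scaleC_state_in_energy_space[OF U]]
        energy_norm_scaleC[of "T t U - scaleC_state ?e U" "- 1"] by (metis mult_1 norm_minus_cancel norm_one)
    also have "\<dots> \<le> 1 / 2 * energy_norm U + t * energy_norm ?G"
    proof -
      have "M * exp (- \<epsilon> * t) * energy_norm U \<le> 1 / 2 * energy_norm U"
        using t energy_norm_nonneg by (intro mult_right_mono) auto
      then show ?thesis using stab[OF t(1) U] dev by linarith
    qed
    finally show "energy_norm U \<le> 2 * t * energy_norm ?G" by simp
  qed (use t in simp)
qed

section \<open>States glued from two smooth pieces\<close>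

lemma abs_glue_simps:
  assumes "continuous_on UNIV f1" "continuous_on UNIV f2"
  shows "scaleC_l2 a (abs_l2 (glue f1 f2)) = abs_l2 (glue (\<lambda>x. a * f1 x) (\<lambda>x. a * f2 x))"
    and "damping (abs_l2 (glue f1 f2)) = abs_l2 (glue (\<lambda>x. 0) f2)"
    and "continuous_on UNIV g1 \<Longrightarrow> continuous_on UNIV g2 \<Longrightarrow>
      abs_l2 (glue f1 f2) + abs_l2 (glue g1 g2) = abs_l2 (glue (\<lambda>x. f1 x + g1 x) (\<lambda>x. f2 x + g2 x))"
    and "continuous_on UNIV g1 \<Longrightarrow> continuous_on UNIV g2 \<Longrightarrow>
      abs_l2 (glue f1 f2) - abs_l2 (glue g1 g2) = abs_l2 (glue (\<lambda>x. f1 x - g1 x) (\<lambda>x. f2 x - g2 x))"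
  using square_integrable_glue[OF assms] square_integrable_glue[of g1 g2]
  by (auto simp: abs_l2_simps glue_def damping_coeff_def fun_eq_iff intro!: arg_cong[where f = abs_l2])

lemma C1_with_deriv_cmult:
  assumes "C1_with_deriv f g" shows "C1_with_deriv (\<lambda>x. a * f x) (\<lambda>x. a * g x)"
  using assms unfolding C1_with_deriv_def
  by (auto intro!: has_vector_derivative_mult_right continuous_on_mult)

text \<open>
  The transmission conditions at the interface: \<open>u\<close>, \<open>y\<close> and the derivative of \<open>y\<close> are continuous, while
  for \<open>u\<close> it is the stress, with the factor \<open>1 + l\<close> on the damped side since \<open>v = l u\<close>, rather than the
  derivative that has to match.
\<close>

lemma glued_state:
  fixes l :: complex and c :: real
  assumes C1: "C1_with_deriv u1 du1" "C1_with_deriv du1 ddu1" "C1_with_deriv u2 du2" "C1_with_deriv du2 ddu2"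
    "C1_with_deriv y1 dy1" "C1_with_deriv dy1 ddy1" "C1_with_deriv y2 dy2" "C1_with_deriv dy2 ddy2"
  and u: "u1 0 = 0" "u2 1 = 0" "u1 (1/2) = u2 (1/2)" "du1 (1/2) = (1 + l) * du2 (1/2)"
  and y: "y1 0 = 0" "y2 1 = 0" "y1 (1/2) = y2 (1/2)" "dy1 (1/2) = dy2 (1/2)"
  defines "U \<equiv> (abs_l2 (glue u1 u2), scaleC_l2 l (abs_l2 (glue u1 u2)),
                abs_l2 (glue y1 y2), scaleC_l2 l (abs_l2 (glue y1 y2)))"
  shows "U \<in> wave_domain"
    and "energy_vector U = (abs_l2 (glue (\<lambda>x. l * u1 x) (\<lambda>x. l * u2 x)), abs_l2 (glue du1 du2),
           abs_l2 (glue (\<lambda>x. l * y1 x) (\<lambda>x. l * y2 x)), abs_l2 (glue dy1 dy2))"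
    and "scaleC_state l U - wave_operator c U =
      (0, abs_l2 (glue (\<lambda>x. l * (l * u1 x) - ddu1 x + c * (l * y1 x))
                       (\<lambda>x. l * (l * u2 x) - (1 + l) * ddu2 x + c * (l * y2 x))),
       0, abs_l2 (glue (\<lambda>x. l * (l * y1 x) - ddy1 x - c * (l * u1 x))
                       (\<lambda>x. l * (l * y2 x) - ddy2 x - c * (l * u2 x))))"
proof -
  have cont: "continuous_on UNIV f" if "C1_with_deriv f g" for f g
    using C1_with_deriv_continuous[OF that] .
  have cont': "continuous_on UNIV g" if "C1_with_deriv f g" for f g
    using that by (simp add: C1_with_deriv_def)
  note c = C1[THEN cont] C1(2,4,6,8)[THEN cont']
  note cs = continuous_on_mult continuous_on_add continuous_on_diff continuous_on_const c
  have uH: "abs_l2 (glue u1 u2) \<in> H1_0" and yH: "abs_l2 (glue y1 y2) \<in> H1_0"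
    using glue_in_H1_0[OF C1(1,3)] glue_in_H1_0[OF C1(5,7)] u y by auto
  have vH: "scaleC_l2 l (abs_l2 (glue u1 u2)) \<in> H1_0" "scaleC_l2 l (abs_l2 (glue y1 y2)) \<in> H1_0"
    using H1_0_combination[OF uH zero_H1_0(1), of l 0] H1_0_combination[OF yH zero_H1_0(1), of l 0]
      norm_scaleC_l2[of 0 0] by auto
  have du: "weak_deriv (abs_l2 (glue u1 u2)) = abs_l2 (glue du1 du2)"
    and dy: "weak_deriv (abs_l2 (glue y1 y2)) = abs_l2 (glue dy1 dy2)"
    by (intro weak_derivI has_weak_deriv_glue C1 u y)+
  have dv: "weak_deriv (scaleC_l2 l (abs_l2 (glue u1 u2))) = scaleC_l2 l (abs_l2 (glue du1 du2))"
    by (simp add: weak_deriv_scaleC H1_0_imp_H1 uH du)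
  have ddy: "has_weak_deriv (abs_l2 (glue dy1 dy2)) (abs_l2 (glue ddy1 ddy2))"
    by (intro has_weak_deriv_glue C1 y)
  have stress: "weak_deriv (abs_l2 (glue u1 u2)) + damping (weak_deriv (scaleC_l2 l (abs_l2 (glue u1 u2)))) =
      abs_l2 (glue du1 (\<lambda>x. (1 + l) * du2 x))"
    by (simp only: du dv) (simp add: abs_glue_simps cs distrib_right)
  have dstress: "has_weak_deriv (abs_l2 (glue du1 (\<lambda>x. (1 + l) * du2 x))) 
      (abs_l2 (glue ddu1 (\<lambda>x. (1 + l) * ddu2 x)))"
    by (intro has_weak_deriv_glue C1 C1_with_deriv_cmult u)
  show "U \<in> wave_domain"
    using uH yH vH H1I[OF ddy] H1I[OF dstress] H1_0_imp_H1[OF yH]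
    by (simp add: U_def wave_domain_def energy_space_def H2_def dy stress)
  show "energy_vector U = (abs_l2 (glue (\<lambda>x. l * u1 x) (\<lambda>x. l * u2 x)), abs_l2 (glue du1 du2),
           abs_l2 (glue (\<lambda>x. l * y1 x) (\<lambda>x. l * y2 x)), abs_l2 (glue dy1 dy2))"
    by (simp add: U_def du dy abs_glue_simps c)
  show "scaleC_state l U - wave_operator c U =
      (0, abs_l2 (glue (\<lambda>x. l * (l * u1 x) - ddu1 x + c * (l * y1 x))
                       (\<lambda>x. l * (l * u2 x) - (1 + l) * ddu2 x + c * (l * y2 x))),
       0, abs_l2 (glue (\<lambda>x. l * (l * y1 x) - ddy1 x - c * (l * u1 x))
                       (\<lambda>x. l * (l * y2 x) - ddy2 x - c * (l * u2 x))))"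
    unfolding U_def wave_operator.simps scaleC_state.simps stress weak_derivI[OF dstress] dy weak_derivI[OF ddy] scaleR_l2_eq
    by (simp add: abs_glue_simps cs algebra_simps)
qed

lemma energy_norm_velocity_le:
  "energy_norm (0, f, 0, g) \<le> norm f + norm g"
  by (simp add: zero_H1_0 sqrt_sum_squares_le_sum)

text \<open>
  The energy density of a quasimode is bounded below on the undamped half only, whence the
  factor \<open>1/2\<close>, the length of that half.
\<close>

lemma energy_lower_bound_left_half:
  assumes c: "continuous_on UNIV f1" "continuous_on UNIV f2" "continuous_on UNIV g1" "continuous_on UNIV g2"
    "continuous_on UNIV h1" "continuous_on UNIV h2" "continuous_on UNIV k1" "continuous_on UNIV k2"
  and m: "\<And>x. 0 < x \<Longrightarrow> x \<le> 1/2 \<Longrightarrow> 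
      m \<le> (cmod (f1 x))\<^sup>2 + (cmod (g1 x))\<^sup>2 + (cmod (h1 x))\<^sup>2 + (cmod (k1 x))\<^sup>2"
  shows "m / 2 \<le> (norm (abs_l2 (glue f1 f2), abs_l2 (glue g1 g2), abs_l2 (glue h1 h2), abs_l2 (glue k1 k2)))\<^sup>2"
proof -
  interpret finite_measure unit_measure by (rule finite_measure_unit)
  note sq = square_integrable_glue[OF c(1,2)] square_integrable_glue[OF c(3,4)] 
    square_integrable_glue[OF c(5,6)] square_integrable_glue[OF c(7,8)]
  note i = sq[unfolded square_integrable_def, THEN conjunct2]
  have nsq: "(norm (abs_l2 f))\<^sup>2 = (LINT x|unit_measure. (cmod (f x))\<^sup>2)" if "square_integrable f" for f
    using that by (simp add: abs_l2_simps)
  let ?G = "\<lambda>x. (cmod (glue f1 f2 x))\<^sup>2 + (cmod (glue g1 g2 x))\<^sup>2 + (cmod (glue h1 h2 x))\<^sup>2 + (cmod (glue k1 k2 x))\<^sup>2"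
  have set: "{0<..1/2} \<in> sets unit_measure"
    by (auto simp: sets_restrict_space_iff)
  have "measure unit_measure {0<..1/2} = measure lebesgue {0<..1/2::real}"
    by (intro measure_restrict_space) auto
  also have "\<dots> = 1/2" by simp
  finally have mu: "measure unit_measure {0<..1/2} = 1/2" .
  have "m / 2 = (LINT x|unit_measure. m * indicator {0<..1/2} x)"
  proof -
    have "{0<..1/2::real} \<inter> {0<..<1} = {0<..1/2}" by auto
    then show ?thesis using set mu by simp
  qed
  also have "\<dots> \<le> (LINT x|unit_measure. ?G x)"
  proof (rule integral_mono)
    show "integrable unit_measure (\<lambda>x. m * indicator {0<..1/2} x)"
      using set by (intro integrable_mult_right integrable_real_indicator) (auto simp: emeasure_eq_measure)
    show "integrable unit_measure ?G"
      by (intro Bochner_Integration.integrable_add i)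
    show "m * indicator {0<..1/2} x \<le> ?G x" if "x \<in> space unit_measure" for x
      using m[of x] that by (auto simp: indicator_def glue_def)
  qed
  also have "\<dots> = (norm (abs_l2 (glue f1 f2)))\<^sup>2 + (norm (abs_l2 (glue g1 g2)))\<^sup>2 
      + (norm (abs_l2 (glue h1 h2)))\<^sup>2 + (norm (abs_l2 (glue k1 k2)))\<^sup>2"
    by (simp add: nsq sq i)
  also have "\<dots> = (norm (abs_l2 (glue f1 f2), abs_l2 (glue g1 g2), abs_l2 (glue h1 h2), abs_l2 (glue k1 k2)))\<^sup>2"
    by (simp add: norm_Pair add.assoc)
  finally show ?thesis .
qed

section \<open>Quasimodes\<close>

lemma cmod_sin_cos_le_1:
  "cmod (sin (complex_of_real a * complex_of_real x)) \<le> 1"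
  "cmod (cos (complex_of_real a * complex_of_real x)) \<le> 1"
  unfolding of_real_mult[symmetric] sin_of_real cos_of_real norm_of_real by simp_all

lemma cmod_mult_le_1: "cmod a \<le> 1 \<Longrightarrow> cmod b \<le> 1 \<Longrightarrow> cmod (a * b) \<le> 1"
  by (simp add: norm_mult mult_le_one)

lemma cmod_square_add_ge: "(cmod a)\<^sup>2 / 2 - (cmod e)\<^sup>2 \<le> (cmod (a + e))\<^sup>2"
proof -
  have "cmod a \<le> cmod (a + e) + cmod e"
    using norm_triangle_ineq4[of "a + e" e] by simp
  then have "(cmod a)\<^sup>2 \<le> (cmod (a + e) + cmod e)\<^sup>2"
    by (intro power_mono) auto
  also have "\<dots> \<le> 2 * (cmod (a + e))\<^sup>2 + 2 * (cmod e)\<^sup>2"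
    using sum_squares_bound[of "cmod (a + e)" "cmod e"] by (simp add: power2_sum)
  finally show ?thesis by linarith
qed

text \<open>
  The exponent \<open>\<mu> = (1 + i) \<surd>(w/2)\<close> of the boundary layer \<open>exp (- \<mu> (x - 1/2))\<close> is the root of
  \<open>\<mu>\<^sup>2 = i w\<close> that decays into the damped half: at frequency \<open>w\<close> the equation there is
  \<open>(1 + i w) u'' + w\<^sup>2 u = 0\<close> up to the coupling, so \<open>u'' \<approx> i w u\<close>. The lower bound on
  \<open>1 + exp (- \<mu>)\<close> lets the amplitude of the layer be found by division.
\<close>

lemma boundary_layer:
  fixes w :: real
  assumes w: "2 \<le> w"
  obtains \<mu> :: complex where "\<mu>\<^sup>2 = \<i> * complex_of_real w" "0 \<le> Re \<mu>" "cmod \<mu> = sqrt w" 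
    "1 / 2 \<le> cmod (1 + exp (- \<mu>))"
proof -
  define r where "r = sqrt (w / 2)"
  have r: "1 \<le> r" "r\<^sup>2 = w / 2" using w by (simp_all add: r_def)
  define \<mu> where "\<mu> = Complex r r"
  show ?thesis
  proof (rule that[of \<mu>])
    show "\<mu>\<^sup>2 = \<i> * complex_of_real w"
      using r(2) by (simp add: \<mu>_def complex_eq_iff power2_eq_square)
    show "0 \<le> Re \<mu>" using r by (simp add: \<mu>_def)
    show "cmod \<mu> = sqrt w" using r by (simp add: \<mu>_def cmod_def)
    have "2 \<le> exp r" using exp_ge_add_one_self[of r] r by linarith
    then have "exp (- r) \<le> 1 / 2" by (simp add: exp_minus field_simps)
    then have "cmod (exp (- \<mu>)) \<le> 1 / 2" by (simp add: \<mu>_def)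
    then show "1 / 2 \<le> cmod (1 + exp (- \<mu>))"
      using norm_triangle_ineq4[of "1 + exp (- \<mu>)" "exp (- \<mu>)"] by simp
  qed
qed

text \<open>
  The leading part is \<open>u = - cos (wx) sin (cx/2)\<close> on the left, and \<open>y = - i sin (wx) cos (cx/2)\<close>
  continued as \<open>- i cos (c/4) sin (wx)\<close> on the right. Its energy density on the left is \<open>w\<^sup>2\<close> up to
  lower order, because \<open>\<bar>v\<bar>\<^sup>2 + \<bar>u\<^sub>x\<bar>\<^sup>2 + \<bar>z\<bar>\<^sup>2 + \<bar>y\<^sub>x\<bar>\<^sup>2\<close> is \<open>w\<^sup>2\<close> times a product of two
  Pythagorean sums. Four corrections turn it into an element of the domain.

  \<^item> \<open>\<alpha> E\<close> on the right is the boundary layer, reflected so as to vanish at \<open>1\<close>. Its amplitude, of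
    order \<open>w\<^sup>-\<^sup>1\<^sup>/\<^sup>2\<close>, balances the stress that the leading part exerts on the interface.

  \<^item> \<open>\<gamma> sin (wx)\<close> on the right is the response of the damped half to the force \<open>- c z\<close>; it is of
    order \<open>w\<^sup>-\<^sup>2\<close> and exerts no stress at \<open>1/2\<close>, since \<open>cos (w/2) = 0\<close>.

  \<^item> \<open>\<beta> sin (wx)\<close> on the left makes \<open>u\<close> continuous. It solves the uncoupled wave equation exactly and
    exerts no stress at \<open>1/2\<close>, again because \<open>cos (w/2) = 0\<close>.

  \<^item> \<open>\<kappa> (2 - 2x) cos (wx)\<close> on the right removes the jump of \<open>y\<^sub>x\<close>, without disturbing the values
    at \<open>1/2\<close> and \<open>1\<close>; \<open>\<kappa>\<close> is of order \<open>1/w\<close>.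

  The largest terms of the residual are of order \<open>w\<^sup>1\<^sup>/\<^sup>2\<close>: they come from the layer, whose exponent
  is only approximate, and from the coupling of \<open>y\<close> to the layer and to \<open>\<beta> sin (wx)\<close>.
\<close>

lemma quasimode:
  fixes c w :: real
  defines "Q \<equiv> (1 + \<bar>c / 2\<bar>)\<^sup>2"
  assumes w: "2 \<le> w" and cosw: "cos (w / 2) = 0"
  obtains U where "U \<in> wave_domain"
    "energy_norm (scaleC_state (\<i> * complex_of_real w) U - wave_operator c U) \<le> 20 * Q * sqrt w"
    "w\<^sup>2 / 4 - 21 * Q * w \<le> (energy_norm U)\<^sup>2"
proof -
  define d where "d = c / 2"
  define W where "W = complex_of_real w"
  define D where "D = complex_of_real d"
  define l where "l = \<i> * W"
  define \<sigma> where "\<sigma> = sin (W / 2)"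
  define S where "S = sin (D / 2)"
  define C where "C = cos (D / 2)"
  obtain \<mu> where \<mu>: "\<mu>\<^sup>2 = \<i> * W" "0 \<le> Re \<mu>" "cmod \<mu> = sqrt w" "1 / 2 \<le> cmod (1 + exp (- \<mu>))"
    using boundary_layer[OF w] unfolding W_def by blast
  have W0: "W \<noteq> 0" using w by (simp add: W_def)
  have normW: "cmod W = w" using w by (simp add: W_def)
  have normD: "cmod D = \<bar>d\<bar>" by (simp add: D_def)
  have cosW: "cos (W / 2) = 0"
  proof -
    have "W / 2 = complex_of_real (w / 2)" by (simp add: W_def)
    then show ?thesis by (simp only: cos_of_real cosw of_real_0)
  qed
  have sinW: "sin W = 0"
    using sin_double[of "W / 2"] cosW by simp
  have \<sigma>2: "\<sigma> * \<sigma> = 1"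
    using sin_cos_squared_add[of "W / 2"] cosW by (simp add: \<sigma>_def power2_eq_square)
  have bnd: "cmod S \<le> 1" "cmod C \<le> 1" "cmod \<sigma> = 1"
  proof -
    show "cmod S \<le> 1" "cmod C \<le> 1"
      using cmod_sin_cos_le_1[of d "1/2"] by (simp_all add: S_def C_def D_def)
    have "(cmod \<sigma>)\<^sup>2 = cmod (\<sigma> * \<sigma>)" by (simp add: norm_mult power2_eq_square)
    then have "cmod \<sigma> = 1 \<or> cmod \<sigma> = - 1" by (simp only: \<sigma>2 norm_one power2_eq_1_iff)
    then show "cmod \<sigma> = 1" using norm_ge_zero[of \<sigma>] by linarith
  qed
  have l1: "w \<le> cmod (1 + l)"
    using abs_Im_le_cmod[of "1 + l"] w by (simp add: l_def W_def)
  then have l10: "1 + l \<noteq> 0" using w by auto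
  have \<mu>0: "\<mu> \<noteq> 0" "1 + exp (- \<mu>) \<noteq> 0" using \<mu>(3,4) w by auto
  define \<gamma> where "\<gamma> = 2 * \<i> * D * C / W\<^sup>2"
  define \<alpha> where "\<alpha> = - (W * \<sigma> * S) / ((1 + l) * (\<mu> * (1 + exp (- \<mu>))))"
  define \<kappa> where "\<kappa> = - \<i> * D * S / W"
  define \<beta> where "\<beta> = \<sigma> * (\<gamma> * \<sigma> + \<alpha> * (1 - exp (- \<mu>)))"
  define s where "s = sqrt w"
  have s: "1 \<le> s" "s * s = w" "0 < s" using w by (simp_all add: s_def)
  have \<alpha>: "cmod \<alpha> \<le> 2 / s"
  proof -
    have "cmod \<alpha> = w * cmod S / (cmod (1 + l) * (s * cmod (1 + exp (- \<mu>))))"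
      using bnd by (simp add: \<alpha>_def norm_mult norm_divide normW \<mu>(3) s_def)
    also have "\<dots> \<le> w * 1 / (w * (s * (1 / 2)))"
      using bnd l1 \<mu>(4) s w by (intro frac_le mult_mono mult_nonneg_nonneg mult_pos_pos) auto
    also have "\<dots> = 2 / s" using w by simp
    finally show ?thesis .
  qed
  have \<alpha>s: "w * cmod \<alpha> \<le> 2 * s"
  proof -
    have "w * cmod \<alpha> \<le> w * (2 / s)" using \<alpha> w by (intro mult_left_mono) auto
    also have "\<dots> = 2 * s" using s by (simp add: field_simps)
    finally show ?thesis .
  qed
  have \<gamma>: "w * w * cmod \<gamma> \<le> 2 * \<bar>d\<bar>"
    using w bnd by (simp add: \<gamma>_def norm_mult norm_divide norm_power normW normD power2_eq_square mult_left_le)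
  have exp\<mu>: "cmod (exp (- \<mu>)) \<le> 1" using \<mu>(2) by simp
  have \<beta>: "w * cmod \<beta> \<le> 2 * \<bar>d\<bar> + 4 * s"
  proof -
    have "cmod \<beta> = cmod (\<gamma> * \<sigma> + \<alpha> * (1 - exp (- \<mu>)))"
      using bnd by (simp add: \<beta>_def norm_mult)
    also have "\<dots> \<le> cmod \<gamma> + cmod \<alpha> * cmod (1 - exp (- \<mu>))"
      using norm_triangle_ineq[of "\<gamma> * \<sigma>" "\<alpha> * (1 - exp (- \<mu>))"] bnd by (simp add: norm_mult)
    also have "\<dots> \<le> cmod \<gamma> + cmod \<alpha> * 2"
    proof -
      have "cmod (1 - exp (- \<mu>)) \<le> 2"
        using norm_triangle_ineq4[of 1 "exp (- \<mu>)"] exp\<mu> unfolding norm_one by linarith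
      then show ?thesis by (intro add_left_mono mult_left_mono) auto
    qed
    finally have "w * cmod \<beta> \<le> w * (cmod \<gamma> + cmod \<alpha> * 2)" using w by (intro mult_left_mono) auto
    moreover have "w * cmod \<gamma> \<le> w * w * cmod \<gamma>" using w by (intro mult_right_mono) auto
    ultimately show ?thesis using \<gamma> \<alpha>s by (simp add: distrib_left)
  qed

  \<comment> \<open>the pieces \<open>1\<close> (left) and \<open>2\<close> (right) as entire functions, with first and second derivatives\<close>
  define E where "E z = exp (- \<mu> * (z - 1/2)) - exp (- \<mu> * (3/2 - z))" for z
  define dE where "dE z = - \<mu> * (exp (- \<mu> * (z - 1/2)) + exp (- \<mu> * (3/2 - z)))" for z
  define u1 where "u1 z = - cos (W * z) * sin (D * z) + \<beta> * sin (W * z)" for z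
  define du1 where "du1 z = W * (sin (W * z) * sin (D * z)) - D * (cos (W * z) * cos (D * z)) + \<beta> * W * cos (W * z)" for z
  define ddu1 where "ddu1 z = W\<^sup>2 * (cos (W * z) * sin (D * z)) + 2 * W * D * (sin (W * z) * cos (D * z)) 
      + D\<^sup>2 * (cos (W * z) * sin (D * z)) - \<beta> * W\<^sup>2 * sin (W * z)" for z
  define u2 where "u2 z = \<gamma> * sin (W * z) + \<alpha> * E z" for z
  define du2 where "du2 z = \<gamma> * W * cos (W * z) + \<alpha> * dE z" for z
  define ddu2 where "ddu2 z = - \<gamma> * W\<^sup>2 * sin (W * z) + \<alpha> * \<mu>\<^sup>2 * E z" for z
  define y1 where "y1 z = - \<i> * sin (W * z) * cos (D * z)" for z
  define dy1 where "dy1 z = - \<i> * W * (cos (W * z) * cos (D * z)) + \<i> * D * (sin (W * z) * sin (D * z))" for z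
  define ddy1 where "ddy1 z = \<i> * W\<^sup>2 * (sin (W * z) * cos (D * z)) + 2 * \<i> * W * D * (cos (W * z) * sin (D * z))
      + \<i> * D\<^sup>2 * (sin (W * z) * cos (D * z))" for z
  define y2 where "y2 z = - \<i> * C * sin (W * z) + \<kappa> * (2 - 2 * z) * cos (W * z)" for z
  define dy2 where "dy2 z = - \<i> * C * W * cos (W * z) - 2 * \<kappa> * cos (W * z) - \<kappa> * W * (2 - 2 * z) * sin (W * z)" for z
  define ddy2 where "ddy2 z = \<i> * C * W\<^sup>2 * sin (W * z) + 4 * \<kappa> * W * sin (W * z) - \<kappa> * W\<^sup>2 * (2 - 2 * z) * cos (W * z)" for z
  have C1: 
    "C1_with_deriv (\<lambda>x. u1 (complex_of_real x)) (\<lambda>x. du1 (complex_of_real x))"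
    "C1_with_deriv (\<lambda>x. du1 (complex_of_real x)) (\<lambda>x. ddu1 (complex_of_real x))"
    "C1_with_deriv (\<lambda>x. u2 (complex_of_real x)) (\<lambda>x. du2 (complex_of_real x))"
    "C1_with_deriv (\<lambda>x. du2 (complex_of_real x)) (\<lambda>x. ddu2 (complex_of_real x))"
    "C1_with_deriv (\<lambda>x. y1 (complex_of_real x)) (\<lambda>x. dy1 (complex_of_real x))"
    "C1_with_deriv (\<lambda>x. dy1 (complex_of_real x)) (\<lambda>x. ddy1 (complex_of_real x))"
    "C1_with_deriv (\<lambda>x. y2 (complex_of_real x)) (\<lambda>x. dy2 (complex_of_real x))"
    "C1_with_deriv (\<lambda>x. dy2 (complex_of_real x)) (\<lambda>x. ddy2 (complex_of_real x))"
  proof -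
    have dE: "(E has_field_derivative dE z) (at z)" "(dE has_field_derivative \<mu>\<^sup>2 * E z) (at z)" for z
      unfolding E_def dE_def
      by (auto intro!: derivative_eq_intros simp: algebra_simps power2_eq_square)
    note [derivative_intros] = DERIV_chain2[OF dE(1)] DERIV_chain2[OF dE(2)]
    show "C1_with_deriv (\<lambda>x. u1 (complex_of_real x)) (\<lambda>x. du1 (complex_of_real x))"
      by (rule C1_with_deriv_of_real) (unfold u1_def du1_def, 
        auto intro!: derivative_eq_intros continuous_intros simp: algebra_simps)
    show "C1_with_deriv (\<lambda>x. du1 (complex_of_real x)) (\<lambda>x. ddu1 (complex_of_real x))"
      by (rule C1_with_deriv_of_real) (unfold du1_def ddu1_def, 
        auto intro!: derivative_eq_intros continuous_intros simp: algebra_simps power2_eq_square)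
    show "C1_with_deriv (\<lambda>x. y1 (complex_of_real x)) (\<lambda>x. dy1 (complex_of_real x))"
      by (rule C1_with_deriv_of_real) (unfold y1_def dy1_def, 
        auto intro!: derivative_eq_intros continuous_intros simp: algebra_simps)
    show "C1_with_deriv (\<lambda>x. dy1 (complex_of_real x)) (\<lambda>x. ddy1 (complex_of_real x))"
      by (rule C1_with_deriv_of_real) (unfold dy1_def ddy1_def, 
        auto intro!: derivative_eq_intros continuous_intros simp: algebra_simps power2_eq_square)
    show "C1_with_deriv (\<lambda>x. y2 (complex_of_real x)) (\<lambda>x. dy2 (complex_of_real x))"
      by (rule C1_with_deriv_of_real) (unfold y2_def dy2_def, 
        auto intro!: derivative_eq_intros continuous_intros simp: algebra_simps)
    show "C1_with_deriv (\<lambda>x. dy2 (complex_of_real x)) (\<lambda>x. ddy2 (complex_of_real x))"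
      by (rule C1_with_deriv_of_real) (unfold dy2_def ddy2_def, 
        auto intro!: derivative_eq_intros continuous_intros simp: algebra_simps power2_eq_square)
    show "C1_with_deriv (\<lambda>x. u2 (complex_of_real x)) (\<lambda>x. du2 (complex_of_real x))"
    proof (rule C1_with_deriv_of_real)
      show "(u2 has_field_derivative du2 z) (at z)" for z
        unfolding u2_def du2_def by (rule derivative_eq_intros dE refl | simp)+
      show "continuous_on UNIV du2"
        unfolding du2_def dE_def by (intro continuous_intros)
    qed
    show "C1_with_deriv (\<lambda>x. du2 (complex_of_real x)) (\<lambda>x. ddu2 (complex_of_real x))"
    proof (rule C1_with_deriv_of_real)
      show "(du2 has_field_derivative ddu2 z) (at z)" for z
        unfolding du2_def ddu2_def by (rule derivative_eq_intros dE refl | simp add: power2_eq_square)+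
      show "continuous_on UNIV ddu2"
        unfolding ddu2_def E_def by (intro continuous_intros)
    qed
  qed
  have half: "cos (W * (1/2)) = 0" "sin (W * (1/2)) = \<sigma>" "sin (D * (1/2)) = S" "cos (D * (1/2)) = C"
    using cosW by (simp_all add: \<sigma>_def S_def C_def)
  have Eh: "E (1/2) = 1 - exp (- \<mu>)" "dE (1/2) = - \<mu> * (1 + exp (- \<mu>))" "E 1 = 0"
    by (simp_all add: E_def dE_def)
  have bu: "u1 0 = 0" "u2 1 = 0" "u1 (1/2) = u2 (1/2)" "du1 (1/2) = (1 + l) * du2 (1/2)"
  proof -
    show "u1 (1/2) = u2 (1/2)"
      unfolding u1_def u2_def half Eh \<beta>_def using \<sigma>2 by (simp add: algebra_simps)
    show "du1 (1/2) = (1 + l) * du2 (1/2)"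
      unfolding du1_def du2_def half Eh using l10 \<mu>0 by (simp add: \<alpha>_def)
  qed (simp_all add: u1_def u2_def sinW Eh)
  have by': "y1 0 = 0" "y2 1 = 0" "y1 (1/2) = y2 (1/2)" "dy1 (1/2) = dy2 (1/2)"
  proof -
    show "y1 (1/2) = y2 (1/2)" "dy1 (1/2) = dy2 (1/2)"
      unfolding y1_def y2_def dy1_def dy2_def half using W0 by (simp_all add: \<kappa>_def)
  qed (simp_all add: y1_def y2_def sinW)

  have cD: "complex_of_real c = 2 * D" by (simp add: D_def d_def)
  have ii: "\<i> * (\<i> * z) = - z" for z by (simp flip: mult.assoc)
  have \<mu>\<mu>: "\<mu> * (\<mu> * z) = \<i> * (W * z)" for z
    using \<mu>(1) by (simp add: power2_eq_square flip: mult.assoc)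
  define t where "t = \<bar>d\<bar>"
  have t: "0 \<le> t" by (simp add: t_def)
  have Qs: "10 * Q * s = 10 * s + 20 * (t * s) + 10 * (t * t * s)"
    by (simp add: Q_def d_def t_def power2_eq_square algebra_simps)
  have ts: "t \<le> t * s" "t * t \<le> t * t * s" "0 \<le> t * s" "0 \<le> t * t * s"
    using t s mult_left_mono[OF s(1), of t] mult_left_mono[OF s(1), of "t * t"] by auto
  have unit: "cmod (sin (W * complex_of_real x)) \<le> 1" "cmod (cos (W * complex_of_real x)) \<le> 1"
    "cmod (sin (D * complex_of_real x)) \<le> 1" "cmod (cos (D * complex_of_real x)) \<le> 1" for x
    unfolding W_def D_def by (rule cmod_sin_cos_le_1)+
  have E_le: "cmod (E (complex_of_real x)) \<le> 2" if "1/2 \<le> x" "x \<le> 1" for x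
  proof -
    have "cmod (exp (- \<mu> * (complex_of_real x - 1/2))) \<le> 1" "cmod (exp (- \<mu> * (3/2 - complex_of_real x))) \<le> 1"
      using that \<mu>(2) by (simp_all add: mult_nonneg_nonneg)
    then show ?thesis
      unfolding E_def using norm_triangle_ineq4 by (smt (verit, best))
  qed
  have \<alpha>E: "cmod (l * \<alpha> * E (complex_of_real x)) \<le> 4 * s" if "1/2 \<le> x" "x \<le> 1" for x
  proof -
    have "cmod (l * \<alpha> * E (complex_of_real x)) = w * cmod \<alpha> * cmod (E (complex_of_real x))"
      by (simp add: l_def norm_mult normW)
    also have "\<dots> \<le> 2 * s * 2"
      by (rule mult_mono[OF \<alpha>s E_le[OF that]]) (use s in auto)
    finally show ?thesis by simp
  qed

  \<comment> \<open>the two nonzero components of the residual: \<open>R1\<close> and \<open>R2\<close> are the left and right pieces of the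
    equation for \<open>u\<close>, \<open>R3\<close> and \<open>R4\<close> those of the equation for \<open>y\<close>\<close>
  define R1 where "R1 z = l * (l * u1 z) - ddu1 z + c * (l * y1 z)" for z
  define R2 where "R2 z = l * (l * u2 z) - (1 + l) * ddu2 z + c * (l * y2 z)" for z
  define R3 where "R3 z = l * (l * y1 z) - ddy1 z - c * (l * u1 z)" for z
  define R4 where "R4 z = l * (l * y2 z) - ddy2 z - c * (l * u2 z)" for z
  \<comment> \<open>in the left pieces all terms of order \<open>w\<^sup>2\<close> and \<open>w\<close> cancel but for those with \<open>\<beta>\<close>; this is where
    the wave numbers \<open>w \<plusminus> c/2\<close> enter\<close>
  have R1_eq: "R1 z = - (D\<^sup>2 * (cos (W * z) * sin (D * z)))" for z
    by (simp add: R1_def u1_def ddu1_def y1_def cD l_def algebra_simps power2_eq_square ii)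
  have R3_eq: "R3 z = - (\<i> * D\<^sup>2 * (sin (W * z) * cos (D * z))) - 2 * \<i> * D * (W * \<beta>) * sin (W * z)" for z
    by (simp add: R3_def u1_def ddy1_def y1_def cD l_def algebra_simps power2_eq_square ii)
  have \<gamma>W: "\<gamma> * W\<^sup>2 = 2 * \<i> * D * C" and \<kappa>W: "\<kappa> * W = - \<i> * D * S"
    using W0 by (simp_all add: \<gamma>_def \<kappa>_def)
  have R2_eq: "R2 z = - (l * \<alpha> * E z) + 2 * D * D * S * (2 - 2 * z) * cos (W * z)" for z
  proof -
    have "R2 z = - (l * \<alpha> * E z) + l * (\<gamma> * W\<^sup>2) * sin (W * z) + 2 * D * W * C * sin (W * z) 
        + 2 * D * \<i> * (\<kappa> * W) * (2 - 2 * z) * cos (W * z)"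
      by (simp add: R2_def u2_def ddu2_def y2_def cD l_def algebra_simps power2_eq_square ii \<mu>\<mu>)
    then show ?thesis
      unfolding \<gamma>W \<kappa>W by (simp add: l_def algebra_simps ii)
  qed
  have R4_eq: "R4 z = - (4 * (\<kappa> * W) * sin (W * z)) - 2 * D * (l * \<gamma>) * sin (W * z) - 2 * D * (l * \<alpha> * E z)" for z
    by (simp add: R4_def u2_def ddy2_def y2_def cD l_def algebra_simps power2_eq_square ii \<mu>\<mu>)
  have R_le: "cmod (R1 (complex_of_real x)) \<le> 10 * Q * s" "cmod (R3 (complex_of_real x)) \<le> 10 * Q * s" for x
  proof -
    let ?z = "complex_of_real x"
    have "cmod (R1 ?z) = t * t * cmod (cos (W * ?z) * sin (D * ?z))"
      by (simp add: R1_eq norm_mult normD t_def power2_eq_square)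
    also have "\<dots> \<le> t * t * 1"
      using t by (intro mult_left_mono cmod_mult_le_1 unit) auto
    finally show "cmod (R1 ?z) \<le> 10 * Q * s"
      using Qs ts s by linarith
    have "cmod (R3 ?z) \<le> cmod (\<i> * D\<^sup>2 * (sin (W * ?z) * cos (D * ?z))) + cmod (2 * \<i> * D * (W * \<beta>) * sin (W * ?z))"
      unfolding R3_eq using norm_triangle_ineq4 by (metis norm_minus_cancel)
    also have "cmod (\<i> * D\<^sup>2 * (sin (W * ?z) * cos (D * ?z))) = t * t * cmod (sin (W * ?z) * cos (D * ?z))"
      by (simp add: norm_mult normD t_def power2_eq_square)
    also have "\<dots> \<le> t * t * 1"
      using t by (intro mult_left_mono cmod_mult_le_1 unit) auto
    also have "cmod (2 * \<i> * D * (W * \<beta>) * sin (W * ?z)) = 2 * t * (w * cmod \<beta>) * cmod (sin (W * ?z))"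
      by (simp add: norm_mult normD normW t_def)
    also have "\<dots> \<le> 2 * t * (2 * t + 4 * s) * 1"
      using t s w \<beta> unit(1) by (intro mult_mono mult_left_mono mult_nonneg_nonneg) (auto simp: t_def)
    also have "t * t * 1 + 2 * t * (2 * t + 4 * s) * 1 = 5 * (t * t) + 8 * (t * s)"
      by (simp add: algebra_simps)
    finally show "cmod (R3 ?z) \<le> 10 * Q * s"
      using Qs ts s by linarith
  qed
  have R_le': "cmod (R2 (complex_of_real x)) \<le> 10 * Q * s" "cmod (R4 (complex_of_real x)) \<le> 10 * Q * s" 
    if x: "1/2 \<le> x" "x \<le> 1" for x
  proof -
    let ?z = "complex_of_real x"
    have "cmod (2 - 2 * ?z) = \<bar>2 - 2 * x\<bar>"
      by (metis norm_of_real of_real_diff of_real_mult of_real_numeral)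
    then have z: "cmod (2 - 2 * ?z) \<le> 1" using x by simp
    have "cmod (R2 ?z) \<le> cmod (l * \<alpha> * E ?z) + cmod (2 * D * D * S * (2 - 2 * ?z) * cos (W * ?z))"
      unfolding R2_eq using norm_triangle_ineq by (metis norm_minus_cancel)
    also have "cmod (2 * D * D * S * (2 - 2 * ?z) * cos (W * ?z)) = 2 * t * t * cmod (S * ((2 - 2 * ?z) * cos (W * ?z)))"
      by (simp add: norm_mult normD t_def)
    also have "\<dots> \<le> 2 * t * t * 1"
      using t by (intro mult_left_mono cmod_mult_le_1 unit bnd z) auto
    finally show "cmod (R2 ?z) \<le> 10 * Q * s"
      using \<alpha>E[OF x] Qs ts s by linarith
    have "cmod (R4 ?z) \<le> cmod (4 * (\<kappa> * W) * sin (W * ?z)) + cmod (2 * D * (l * \<gamma>) * sin (W * ?z)) 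
        + cmod (2 * D * (l * \<alpha> * E ?z))"
      unfolding R4_eq by (smt (verit, best) norm_minus_cancel norm_triangle_ineq4)
    also have "cmod (4 * (\<kappa> * W) * sin (W * ?z)) = 4 * t * cmod (S * sin (W * ?z))"
      unfolding \<kappa>W by (simp add: norm_mult normD t_def)
    also have "\<dots> \<le> 4 * t * 1"
      using t by (intro mult_left_mono cmod_mult_le_1 unit bnd) auto
    also have "cmod (2 * D * (l * \<gamma>) * sin (W * ?z)) = 2 * t * ((w * cmod \<gamma>) * cmod (sin (W * ?z)))"
      by (simp add: norm_mult normD normW t_def l_def)
    also have "\<dots> \<le> 2 * t * (2 * t * 1)"
    proof -
      have "w * cmod \<gamma> \<le> w * w * cmod \<gamma>" using w by (intro mult_right_mono) auto
      then have "w * cmod \<gamma> \<le> 2 * t" using \<gamma> by (simp add: t_def)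
      from mult_mono[OF this unit(1)] show ?thesis using t by (intro mult_left_mono) auto
    qed
    also have "cmod (2 * D * (l * \<alpha> * E ?z)) = 2 * t * cmod (l * \<alpha> * E ?z)"
      by (simp add: norm_mult normD t_def)
    also have "\<dots> \<le> 2 * t * (4 * s)"
      using t by (intro mult_left_mono \<alpha>E x) auto
    also have "4 * t * 1 + 2 * t * (2 * t * 1) + 2 * t * (4 * s) = 4 * t + 4 * (t * t) + 8 * (t * s)"
      by (simp add: algebra_simps)
    finally show "cmod (R4 ?z) \<le> 10 * Q * s"
      using Qs ts s by linarith
  qed

  have cont: "continuous_on UNIV f" if "C1_with_deriv f g" for f g
    using C1_with_deriv_continuous[OF that] .
  have cont': "continuous_on UNIV g" if "C1_with_deriv f g" for f g
    using that by (simp add: C1_with_deriv_def)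
  note cs = C1[THEN cont] C1(2,4,6,8)[THEN cont']
  define u where "u = abs_l2 (glue (\<lambda>x. u1 (complex_of_real x)) (\<lambda>x. u2 (complex_of_real x)))"
  define y where "y = abs_l2 (glue (\<lambda>x. y1 (complex_of_real x)) (\<lambda>x. y2 (complex_of_real x)))"
  define U where "U = (u, scaleC_l2 l u, y, scaleC_l2 l y)"
  have bur: "u1 (complex_of_real 0) = 0" "u2 (complex_of_real 1) = 0" 
    "u1 (complex_of_real (1/2)) = u2 (complex_of_real (1/2))"
    "du1 (complex_of_real (1/2)) = (1 + l) * du2 (complex_of_real (1/2))"
    using bu by simp_all
  have byr: "y1 (complex_of_real 0) = 0" "y2 (complex_of_real 1) = 0" 
    "y1 (complex_of_real (1/2)) = y2 (complex_of_real (1/2))"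
    "dy1 (complex_of_real (1/2)) = dy2 (complex_of_real (1/2))"
    using by' by simp_all
  note gs = glued_state[OF C1 bur byr, folded u_def y_def U_def]
  show ?thesis
  proof (rule that[of U])
    show "U \<in> wave_domain" by (rule gs(1))
    have "norm (abs_l2 (glue (\<lambda>x. R1 (complex_of_real x)) (\<lambda>x. R2 (complex_of_real x)))) \<le> 10 * Q * s"
    proof (rule norm_abs_l2_le)
      show "square_integrable (glue (\<lambda>x. R1 (complex_of_real x)) (\<lambda>x. R2 (complex_of_real x)))"
        unfolding R1_def R2_def
        by (intro square_integrable_glue continuous_on_add continuous_on_diff continuous_on_mult continuous_on_const cs)
    qed (use R_le(1) R_le'(1) s in \<open>auto simp: glue_def Q_def\<close>)
    moreover have "norm (abs_l2 (glue (\<lambda>x. R3 (complex_of_real x)) (\<lambda>x. R4 (complex_of_real x)))) \<le> 10 * Q * s"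
    proof (rule norm_abs_l2_le)
      show "square_integrable (glue (\<lambda>x. R3 (complex_of_real x)) (\<lambda>x. R4 (complex_of_real x)))"
        unfolding R3_def R4_def
        by (intro square_integrable_glue continuous_on_add continuous_on_diff continuous_on_mult continuous_on_const cs)
    qed (use R_le(2) R_le'(2) s in \<open>auto simp: glue_def Q_def\<close>)
    ultimately have "energy_norm (scaleC_state l U - wave_operator c U) \<le> 10 * Q * s + 10 * Q * s"
      unfolding gs(3) R1_def R2_def R3_def R4_def
      by (intro order_trans[OF energy_norm_velocity_le] add_mono)
    then show "energy_norm (scaleC_state (\<i> * complex_of_real w) U - wave_operator c U) \<le> 20 * Q * sqrt w"
      by (simp add: l_def W_def s_def)
    have "(w\<^sup>2 / 2 - 42 * Q * w) / 2 \<le> (norm (energy_vector U))\<^sup>2"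
      unfolding gs(2)
    proof (rule energy_lower_bound_left_half)
      fix x :: real
      define z where "z = complex_of_real x"
      define A B p q where "A = sin (W * z)" and "B = cos (W * z)" and "p = sin (D * z)" and "q = cos (D * z)"
      note abbr = A_def[symmetric] B_def[symmetric] p_def[symmetric] q_def[symmetric]
      have le1: "cmod A \<le> 1" "cmod B \<le> 1" "cmod p \<le> 1" "cmod q \<le> 1"
        unfolding A_def B_def p_def q_def z_def by (rule unit)+
      have unitsq: "(cmod (sin (complex_of_real r)))\<^sup>2 + (cmod (cos (complex_of_real r)))\<^sup>2 = 1" for r
        by (simp add: sin_of_real cos_of_real)
      have sq: "(cmod A)\<^sup>2 + (cmod B)\<^sup>2 = 1" "(cmod p)\<^sup>2 + (cmod q)\<^sup>2 = 1"
        using unitsq[of "w * x"] unitsq[of "d * x"] 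
        by (simp_all add: A_def B_def p_def q_def z_def W_def D_def)
      \<comment> \<open>the leading part of the energy density is exactly \<open>w\<^sup>2\<close>\<close>
      have main: "(cmod (W * (B * p)))\<^sup>2 + (cmod (W * (A * p)))\<^sup>2 + (cmod (W * (A * q)))\<^sup>2 + (cmod (W * (B * q)))\<^sup>2 = w\<^sup>2"
      proof -
        have "(cmod (W * (B * p)))\<^sup>2 + (cmod (W * (A * p)))\<^sup>2 + (cmod (W * (A * q)))\<^sup>2 + (cmod (W * (B * q)))\<^sup>2 
          = w\<^sup>2 * (((cmod A)\<^sup>2 + (cmod B)\<^sup>2) * ((cmod p)\<^sup>2 + (cmod q)\<^sup>2))"
          by (simp add: norm_mult normW power_mult_distrib algebra_simps)
        then show ?thesis by (simp add: sq)
      qed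
      define b where "b = 2 * t + 4 * s"
      have W\<beta>: "cmod (W * \<beta>) \<le> b" using \<beta> by (simp add: norm_mult normW b_def t_def)
      have e1: "cmod (l * \<beta> * A) \<le> b"
      proof -
        have "cmod (l * \<beta> * A) = cmod (W * \<beta>) * cmod A" by (simp add: l_def norm_mult)
        also have "\<dots> \<le> cmod (W * \<beta>) * 1" by (intro mult_left_mono le1) auto
        finally show ?thesis using W\<beta> by simp
      qed
      have e2: "cmod (\<beta> * W * B - D * (B * q)) \<le> b + t"
      proof -
        have "cmod (\<beta> * W * B - D * (B * q)) \<le> cmod (W * \<beta>) * cmod B + t * cmod (B * q)"
          using norm_triangle_ineq4[of "\<beta> * W * B" "D * (B * q)"] by (simp add: norm_mult normD t_def mult_ac)
        also have "\<dots> \<le> cmod (W * \<beta>) * 1 + t * 1"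
          using t by (intro add_mono mult_left_mono le1 cmod_mult_le_1) auto
        finally show ?thesis using W\<beta> by simp
      qed
      have e4: "cmod (\<i> * D * (A * p)) \<le> t"
      proof -
        have "cmod (\<i> * D * (A * p)) = t * cmod (A * p)" by (simp add: norm_mult normD t_def)
        also have "\<dots> \<le> t * 1" using t by (intro mult_left_mono cmod_mult_le_1 le1)
        finally show ?thesis by simp
      qed
      have g1: "(cmod (W * (B * p)))\<^sup>2 / 2 - b\<^sup>2 \<le> (cmod (l * u1 z))\<^sup>2"
      proof -
        have "l * u1 z = - l * B * p + l * \<beta> * A" by (simp add: u1_def abbr algebra_simps)
        then have "(cmod (- l * B * p))\<^sup>2 / 2 - (cmod (l * \<beta> * A))\<^sup>2 \<le> (cmod (l * u1 z))\<^sup>2"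
          using cmod_square_add_ge[of "- l * B * p" "l * \<beta> * A"] by simp
        moreover have "cmod (- l * B * p) = cmod (W * (B * p))" by (simp add: l_def norm_mult)
        moreover have "(cmod (l * \<beta> * A))\<^sup>2 \<le> b\<^sup>2" using e1 by (intro power_mono) auto
        ultimately show ?thesis by (metis diff_left_mono order_trans)
      qed
      have g2: "(cmod (W * (A * p)))\<^sup>2 / 2 - (b + t)\<^sup>2 \<le> (cmod (du1 z))\<^sup>2"
      proof -
        have "du1 z = W * (A * p) + (\<beta> * W * B - D * (B * q))" by (simp add: du1_def abbr)
        then have "(cmod (W * (A * p)))\<^sup>2 / 2 - (cmod (\<beta> * W * B - D * (B * q)))\<^sup>2 \<le> (cmod (du1 z))\<^sup>2"
          using cmod_square_add_ge by metis
        moreover have "(cmod (\<beta> * W * B - D * (B * q)))\<^sup>2 \<le> (b + t)\<^sup>2" using e2 by (intro power_mono) auto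
        ultimately show ?thesis by (metis diff_left_mono order_trans)
      qed
      have g3: "(cmod (W * (A * q)))\<^sup>2 \<le> (cmod (l * y1 z))\<^sup>2"
        by (simp add: y1_def l_def abbr norm_mult)
      have g4: "(cmod (W * (B * q)))\<^sup>2 / 2 - t\<^sup>2 \<le> (cmod (dy1 z))\<^sup>2"
      proof -
        have "dy1 z = - \<i> * W * (B * q) + \<i> * D * (A * p)" by (simp add: dy1_def abbr)
        then have "(cmod (- \<i> * W * (B * q)))\<^sup>2 / 2 - (cmod (\<i> * D * (A * p)))\<^sup>2 \<le> (cmod (dy1 z))\<^sup>2"
          using cmod_square_add_ge by metis
        moreover have "cmod (- \<i> * W * (B * q)) = cmod (W * (B * q))" by (simp add: norm_mult)
        moreover have "(cmod (\<i> * D * (A * p)))\<^sup>2 \<le> t\<^sup>2" using e4 by (intro power_mono) auto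
        ultimately show ?thesis by (metis diff_left_mono order_trans)
      qed
      have "b\<^sup>2 + (b + t)\<^sup>2 + t\<^sup>2 \<le> 42 * Q * w"
      proof -
        have "s \<le> w" using s mult_left_mono[OF s(1), of s] by simp
        then have "t * s \<le> t * w" using t by (rule mult_left_mono)
        moreover have "t * t * 1 \<le> t * t * w" using t w by (intro mult_left_mono) auto
        moreover have "b\<^sup>2 + (b + t)\<^sup>2 + t\<^sup>2 = 14 * (t * t) + 40 * (t * s) + 32 * w"
          unfolding s(2)[symmetric] by (simp add: b_def power2_eq_square algebra_simps)
        moreover have "Q * w = w + 2 * (t * w) + t * t * w"
          by (simp add: Q_def d_def t_def power2_eq_square algebra_simps)
        moreover have "0 \<le> t * t * w" "0 \<le> t * w" "0 \<le> w" using t w by auto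
        ultimately show ?thesis by linarith
      qed
      then show "w\<^sup>2 / 2 - 42 * Q * w \<le> (cmod (l * u1 (complex_of_real x)))\<^sup>2 + (cmod (du1 (complex_of_real x)))\<^sup>2 
          + (cmod (l * y1 (complex_of_real x)))\<^sup>2 + (cmod (dy1 (complex_of_real x)))\<^sup>2"
        using g1 g2 g3 g4 main unfolding z_def[symmetric] by (smt (verit) zero_le_power2 field_sum_of_halves)
    qed (intro continuous_on_mult continuous_on_const cs)+
    then show "w\<^sup>2 / 4 - 21 * Q * w \<le> (energy_norm U)\<^sup>2"
      by (simp add: energy_norm_eq)
  qed
qed

theorem theorem3p2:
  fixes c :: real and T :: "real \<Rightarrow> state \<Rightarrow> state"
  assumes "C0_contraction_semigroup T"
    and "is_generator wave_domain (wave_operator c) T"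
  shows "\<not> exponentially_stable T"
proof
  assume "exponentially_stable T"
  then obtain K where K: "K > 0" "\<And>U F w. has_generator_value T U F \<Longrightarrow>
    energy_norm U \<le> K * energy_norm (scaleC_state (\<i> * complex_of_real w) U - F)"
    using exponentially_stable_imp_resolvent_bound[OF assms(1)] by metis
  define Q where "Q = (1 + \<bar>c / 2\<bar>)\<^sup>2"
  \<comment> \<open>squaring the resolvent bound for a quasimode of frequency \<open>w\<close> gives \<open>w \<le> M - 1\<close>\<close>
  define M where "M = 4 * ((20 * K * Q)\<^sup>2 + 21 * Q) + 1"
  obtain n :: nat where n: "max 2 M \<le> real n" using real_arch_simple by blast
  define w where "w = (2 * real n + 1) * pi"
  have "max 2 M \<le> real n * 1" using n by simp
  also have "\<dots> \<le> (2 * real n + 1) * pi" using pi_ge_two by (intro mult_mono) auto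
  finally have w: "2 \<le> w" "M \<le> w" by (simp_all add: w_def)
  have "cos (w / 2) = 0"
    unfolding cos_zero_iff_int by (rule exI[of _ "2 * int n + 1"]) (simp add: w_def)
  with w(1) obtain U where U: "U \<in> wave_domain"
    "energy_norm (scaleC_state (\<i> * complex_of_real w) U - wave_operator c U) \<le> 20 * Q * sqrt w"
    "w\<^sup>2 / 4 - 21 * Q * w \<le> (energy_norm U)\<^sup>2"
    using quasimode[of w c] unfolding Q_def by blast
  have "has_generator_value T U (wave_operator c U)"
    using assms(2) U(1) unfolding is_generator_def by blast
  then have "energy_norm U \<le> K * (20 * Q * sqrt w)"
    using order_trans[OF K(2) mult_left_mono[OF U(2)]] K(1) by auto
  then have "(energy_norm U)\<^sup>2 \<le> (K * (20 * Q * sqrt w))\<^sup>2"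
    by (intro power_mono energy_norm_nonneg)
  also have "\<dots> = (20 * K * Q)\<^sup>2 * w"
    using w(1) by (simp add: power_mult_distrib)
  finally have "w * w \<le> (M - 1) * w"
    using U(3) by (simp add: M_def power2_eq_square algebra_simps)
  then have "w \<le> M - 1" using w(1) by simp
  then show False using w(2) by simp
qed

end
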